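(* Let $\xi:\mathbb{R}^{D\times D}\to\mathbb{R}$ be smooth and strictly convex on $S^D_+$. For every $1$-Lipschitz and pre-concave function $\varphi:\mathcal P^\uparrow_\xi\to\mathbb{R}$, the function $\bar\varphi:\mathcal M_1(\mathcal K_\xi)\to\mathbb{R}$ is a $1$-Lipschitz and concave extension of $\varphi$. In addition, for every $\mu'\in\mathcal M_1(\mathcal K_\xi)$, \[\bar\varphi(\mu')=\min_{\chi\in\mathcal L_{\le1}(\mathcal K_\xi)}\Big\{\int\chi\,\mathrm d\mu'-\varphi^\xi_*(\chi)\Big\}.\]
   Context: $S^D$: symmetric $D\times D$ matrices with Frobenius product and norm $|\cdot|$; $S^D_+$: positive semidefinite cone; $B(0,1)$: closed unit ball of $S^D$; $\nabla\xi$: Frobenius gradient. $\mathcal K_\xi=\nabla\xi(B(0,1)\cap S^D_+)$, $x_0=\nabla\xi(0)$. $U$ is uniform on $[0,1)$; $\mathcal P^\uparrow_\xi=\{\mathrm{Law}(\nabla\xi(\mathsf q(U))):\mathsf q:[0,1)\to S^D_+$ right-continuous with left limits, nondecreasing ($\mathsf q(v)-\mathsf q(u)\in S^D_+$ for $u\le v$), $|\mathsf q(u)|\le1$ for all $u\}$. $\mathcal L(\mathcal K_\xi)$: Lipschitz functions $\chi:\mathcal K_\xi\to\mathbb{R}$ with norm $|\chi|_{\mathcal L}=\max\{|\chi(x_0)|,|\chi|_{\mathrm{Lip}}\}$; $\mathcal L_{\le1}(\mathcal K_\xi)$ its closed unit ball. For signed Borel measures $\nu$ on $\mathcal K_\xi$,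 $|\nu|_{\mathcal M}=\sup_{\chi\in\mathcal L_{\le1}(\mathcal K_\xi)}\int\chi\,\mathrm d\nu$; $\mathcal M_1(\mathcal K_\xi)$ is the completion for this norm, $d(\nu,\nu')=|\nu-\nu'|_{\mathcal M}$ (on probability measures this is the $1$-Wasserstein distance), and $\mu\mapsto\int\chi\,\mathrm d\mu$ extends continuously for $\chi\in\mathcal L(\mathcal K_\xi)$. $\varphi$ is pre-concave if for all $\mu,\nu\in\mathcal P^\uparrow_\xi$, $\lambda\in[0,1]$ with $\lambda\mu+(1-\lambda)\nu\in\mathcal P^\uparrow_\xi$: $\lambda\varphi(\mu)+(1-\lambda)\varphi(\nu)\le\varphi(\lambda\mu+(1-\lambda)\nu)$. For $\eta$ a Borel probability measure on $(\mathcal P^\uparrow_\xi,d)$, $\mathrm{Bar}(\eta)$ is the probability measure $A\mapsto\int\nu(A)\,\mathrm d\eta(\nu)$. For continuous $\varphi$: $\bar\varphi(\mu')=\sup_{\eta\in\mathcal P(\mathcal P^\uparrow_\xi)}\{\int\varphi\,\mathrm d\eta-d(\mathrm{Bar}(\eta),\mu')\}$ and $\varphi^\xi_*(\chi)=\inf_{\mu\in\mathcal P^\uparrow_\xi}\{\int\chi\,\mathrm d\mu-\varphi(\mu)\}$. *)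

theory Defs
  imports "HOL-Analysis.Analysis" "HOL-Probability.Probability"
begin

(* D x D real matrices: real^'n^'n ('n finite, D = CARD('n)).  The inner product
   of real^'n^'n is exactly the Frobenius product, so norm = Frobenius norm. *)

definition sym_mat :: "real^'n^'n \<Rightarrow> bool" where
  "sym_mat A \<longleftrightarrow> transpose A = A"

definition psd :: "real^'n::finite^'n \<Rightarrow> bool" where
  "psd A \<longleftrightarrow> sym_mat A \<and> (\<forall>x. 0 \<le> x \<bullet> (A *v x))"

definition strictly_convex_on :: "'a::real_vector set \<Rightarrow> ('a \<Rightarrow> real) \<Rightarrow> bool" where
  "strictly_convex_on S f \<longleftrightarrow> convex S \<and>
     (\<forall>x\<in>S. \<forall>y\<in>S. x \<noteq> y \<longrightarrow> (\<forall>t::real. 0 < t \<and> t < 1 \<longrightarrow>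
        f ((1 - t) *\<^sub>R x + t *\<^sub>R y) < (1 - t) * f x + t * f y))"

(* smooth (C^infinity): every iterated directional derivative exists and is
   (Frechet) differentiable everywhere *)
coinductive smooth_fun :: "('a::real_normed_vector \<Rightarrow> real) \<Rightarrow> bool" where
  "(\<forall>x. f differentiable (at x)) \<Longrightarrow>
   (\<forall>v. smooth_fun (\<lambda>x. frechet_derivative f (at x) v)) \<Longrightarrow> smooth_fun f"

definition grad :: "('a::real_inner \<Rightarrow> real) \<Rightarrow> 'a \<Rightarrow> 'a" where
  "grad f x = (SOME g. GDERIV f x :> g)"

definition Kxi :: "(real^'n::finite^'n \<Rightarrow> real) \<Rightarrow> (real^'n^'n) set" where
  "Kxi \<xi> = grad \<xi> ` {A. psd A \<and> norm A \<le> 1}"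

definition x0 :: "(real^'n::finite^'n \<Rightarrow> real) \<Rightarrow> real^'n^'n" where
  "x0 \<xi> = grad \<xi> 0"

definition admissible_path :: "(real \<Rightarrow> real^'n::finite^'n) \<Rightarrow> bool" where
  "admissible_path q \<longleftrightarrow>
     (\<forall>u\<in>{0..<1}. psd (q u) \<and> norm (q u) \<le> 1) \<and>
     (\<forall>u\<in>{0..<1}. \<forall>v\<in>{0..<1}. u \<le> v \<longrightarrow> psd (q v - q u)) \<and>
     (\<forall>u\<in>{0..<1}. continuous (at_right u) q) \<and>
     (\<forall>u\<in>{0<..<1}. \<exists>l. (q \<longlongrightarrow> l) (at_left u))"

abbreviation Kspace :: "(real^'n::finite^'n \<Rightarrow> real) \<Rightarrow> (real^'n^'n) measure" where
  "Kspace \<xi> \<equiv> restrict_space borel (Kxi \<xi>)"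

definition Pup :: "(real^'n::finite^'n \<Rightarrow> real) \<Rightarrow> (real^'n^'n) measure set" where
  "Pup \<xi> = {distr (lebesgue_on {0..<1}) (Kspace \<xi>) (\<lambda>u. grad \<xi> (q u)) | q. admissible_path q}"

(* closed unit ball of L(K_xi): max{|chi(x0)|, Lip(chi)} \<le> 1, conditions on K_xi *)
definition Lip_ball :: "(real^'n::finite^'n \<Rightarrow> real) \<Rightarrow> (real^'n^'n \<Rightarrow> real) set" where
  "Lip_ball \<xi> = {ch. abs (ch (x0 \<xi>)) \<le> 1 \<and>
      (\<forall>x\<in>Kxi \<xi>. \<forall>y\<in>Kxi \<xi>. abs (ch x - ch y) \<le> dist x y)}"

(* elements of M_1(K_xi) are represented by the functionals chi \<mapsto> \<integral> chi d\<mu> *)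
type_synonym 'n mfun = "(real^'n^'n \<Rightarrow> real) \<Rightarrow> real"

definition emb :: "(real^'n::finite^'n) measure \<Rightarrow> 'n mfun" where
  "emb \<mu> = (\<lambda>ch. integral\<^sup>L \<mu> ch)"

definition dM :: "(real^'n::finite^'n \<Rightarrow> real) \<Rightarrow> 'n mfun \<Rightarrow> 'n mfun \<Rightarrow> real" where
  "dM \<xi> F G = (SUP ch\<in>Lip_ball \<xi>. F ch - G ch)"

definition finite_K_measure :: "(real^'n::finite^'n \<Rightarrow> real) \<Rightarrow> (real^'n^'n) measure \<Rightarrow> bool" where
  "finite_K_measure \<xi> \<nu> \<longleftrightarrow> finite_measure \<nu> \<and> sets \<nu> = sets (Kspace \<xi>) \<and> space \<nu> = Kxi \<xi>"

(* M_1(K_xi): completion of the signed Borel measures (nu1 - nu2) for the norm |.|_M,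
   realised as the closure of their functionals (uniformly on the unit ball) *)
definition M1 :: "(real^'n::finite^'n \<Rightarrow> real) \<Rightarrow> 'n mfun set" where
  "M1 \<xi> = {F. \<forall>e>0. \<exists>\<nu>1 \<nu>2. finite_K_measure \<xi> \<nu>1 \<and> finite_K_measure \<xi> \<nu>2 \<and>
      (\<forall>ch\<in>Lip_ball \<xi>. \<bar>F ch - (integral\<^sup>L \<nu>1 ch - integral\<^sup>L \<nu>2 ch)\<bar> \<le> e)}"

(* distance on P^up_xi (1-Wasserstein) *)
definition dP :: "(real^'n::finite^'n \<Rightarrow> real) \<Rightarrow> (real^'n^'n) measure \<Rightarrow> (real^'n^'n) measure \<Rightarrow> real" where
  "dP \<xi> \<mu> \<nu> = dM \<xi> (emb \<mu>) (emb \<nu>)"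

definition Pup_open :: "(real^'n::finite^'n \<Rightarrow> real) \<Rightarrow> (real^'n^'n) measure set set" where
  "Pup_open \<xi> = {U. U \<subseteq> Pup \<xi> \<and> (\<forall>\<mu>\<in>U. \<exists>e>0. \<forall>\<nu>\<in>Pup \<xi>. dP \<xi> \<mu> \<nu> < e \<longrightarrow> \<nu> \<in> U)}"

definition Pup_borel :: "(real^'n::finite^'n \<Rightarrow> real) \<Rightarrow> (real^'n^'n) measure measure" where
  "Pup_borel \<xi> = sigma (Pup \<xi>) (Pup_open \<xi>)"

definition PP :: "(real^'n::finite^'n \<Rightarrow> real) \<Rightarrow> (real^'n^'n) measure measure set" where
  "PP \<xi> = {\<eta>. prob_space \<eta> \<and> sets \<eta> = sets (Pup_borel \<xi>) \<and> space \<eta> = Pup \<xi>}"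

definition Bar :: "(real^'n::finite^'n \<Rightarrow> real) \<Rightarrow> (real^'n^'n) measure measure \<Rightarrow> (real^'n^'n) measure" where
  "Bar \<xi> \<eta> = measure_of (Kxi \<xi>) (sets (Kspace \<xi>)) (\<lambda>A. \<integral>\<^sup>+ \<nu>. emeasure \<nu> A \<partial>\<eta>)"

definition phi_bar :: "(real^'n::finite^'n \<Rightarrow> real) \<Rightarrow> ((real^'n^'n) measure \<Rightarrow> real) \<Rightarrow> 'n mfun \<Rightarrow> real" where
  "phi_bar \<xi> \<phi> F = (SUP \<eta>\<in>PP \<xi>. integral\<^sup>L \<eta> \<phi> - dM \<xi> (emb (Bar \<xi> \<eta>)) F)"

definition phi_star :: "(real^'n::finite^'n \<Rightarrow> real) \<Rightarrow> ((real^'n^'n) measure \<Rightarrow> real) \<Rightarrow> (real^'n^'n \<Rightarrow> real) \<Rightarrow> real" where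
  "phi_star \<xi> \<phi> ch = (INF \<mu>\<in>Pup \<xi>. integral\<^sup>L \<mu> ch - \<phi> \<mu>)"

definition pre_concave :: "(real^'n::finite^'n \<Rightarrow> real) \<Rightarrow> ((real^'n^'n) measure \<Rightarrow> real) \<Rightarrow> bool" where
  "pre_concave \<xi> \<phi> \<longleftrightarrow> (\<forall>\<mu>\<in>Pup \<xi>. \<forall>\<nu>\<in>Pup \<xi>. \<forall>\<rho>\<in>Pup \<xi>. \<forall>t::real. 0 \<le> t \<and> t \<le> 1 \<and>
      (\<forall>A\<in>sets (Kspace \<xi>). measure \<rho> A = t * measure \<mu> A + (1 - t) * measure \<nu> A) \<longrightarrow>
      t * \<phi> \<mu> + (1 - t) * \<phi> \<nu> \<le> \<phi> \<rho>)"

end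

theory Submission
  imports Defs
begin

text \<open>
  Modulo values off \<open>K\<close>, the Lipschitz ball is compact for pointwise convergence, and the functionals
  in \<open>M1\<close> are affine and continuous on it. A minimax theorem therefore turns the supremum over \<open>\<eta>\<close>
  into the minimum over \<open>\<chi>\<close>, where finitely supported \<open>\<eta>\<close> already suffice. The Lipschitz bound
  and concavity are read off the minimum.

  For the extension property let \<open>\<rho> = \<Sum> w\<^sub>i \<nu>\<^sub>i\<close> and let \<open>\<mu>\<close> be the law of an increasing path, which may
  be assumed to have finitely many values. Every probability measure supported on these
  values is again the law of an increasing path, so on such measures pre-concavity is concavity and
  Jensen's inequality holds. Transporting all \<open>\<nu>\<^sub>i\<close> to this support by one common kernel \<open>\<kappa>\<close> gives
  \<open>\<Sum> w\<^sub>i \<phi>(\<nu>\<^sub>i) \<le> \<phi>(\<kappa>\<rho>) + cost \<le> \<phi>(\<mu>) + d(\<kappa>\<rho>, \<mu>) + cost\<close>. By the minimax theorem again, now between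
  kernels and Lipschitz functions, \<open>\<kappa>\<close> can be chosen with \<open>d(\<kappa>\<rho>, \<mu>) + cost\<close> arbitrarily close to
  \<open>d(\<rho>, \<mu>)\<close> or below it; this replaces Kantorovich-Rubinstein duality.
\<close>

section \<open>A minimax theorem\<close>

text \<open>The obstacle is that \<open>Pup\<close> need not be convex: a mixture \<rho> of laws of
  increasing paths may fail to be such a law. Then \<open>\<phi>\<close> has no value at \<rho>, and
  neither pre-concavity nor the Lipschitz bound applies to \<rho> directly. Moving each component of
  \<rho> to \<mu> separately would cost the averaged distance of the components to \<mu>, which can
  exceed the distance from \<rho> to \<mu>. A common kernel avoids this loss: its cost and its image
  depend linearly on the measure, so for the mixture they are those of \<rho> alone, while the image
  of every component stays on the same chain.

  In both uses of minimax the compact side is the Lipschitz ball. The other side has only an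
  algebraic structure: finitely supported weights on \<open>Pup\<close>, which stand in for the
  missing convexity, or kernels, in which the payoff is affine. Minimax works at strict levels c. In
  the dual problem the strictness comes from arguing by contradiction; for kernels it costs an
  arbitrarily small slack.\<close>

lemma minimax_two_points:
  fixes f :: "'a::topological_space \<Rightarrow> 'b \<Rightarrow> real"
  assumes "compact X"
    and cont: "continuous_on X (\<lambda>x. f x y)" "continuous_on X (\<lambda>x. f x z)"
    and convexlike: "\<And>x x' t. x \<in> X \<Longrightarrow> x' \<in> X \<Longrightarrow> 0 \<le> t \<Longrightarrow> t \<le> 1 \<Longrightarrow>
      \<exists>x''\<in>X. \<forall>u\<in>{y, z}. f x'' u \<le> t * f x u + (1 - t) * f x' u"
    and above: "\<And>x. x \<in> X \<Longrightarrow> c < f x y \<or> c < f x z"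
  shows "\<exists>t\<in>{0..1}. \<forall>x\<in>X. c < t * f x y + (1 - t) * f x z"
proof (cases "X = {}")
  case True
  then show ?thesis by (intro bexI[of _ 0]) auto
next
  case False
  have "continuous_on X (\<lambda>x. max (f x y) (f x z))"
    using cont by (intro continuous_intros)
  then obtain x0 where x0: "x0 \<in> X" "\<And>x. x \<in> X \<Longrightarrow> max (f x0 y) (f x0 z) \<le> max (f x y) (f x z)"
    using continuous_attains_inf[OF \<open>compact X\<close> False] by blast
  define m where "m = max (f x0 y) (f x0 z)"
  have "c < m" using above[OF x0(1)] by (auto simp: m_def)
  define Q where "Q = {..<m} \<times> {..<m}"
  \<comment> \<open>The upper hull of the image of X. Passing to the hull makes it convex although
    \<open>convexlike\<close> gives only inequalities, and later forces both coordinates of the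
    separating normal to be nonnegative. It misses the quadrant \<open>Q\<close> because m is the
    least value of the maximum.\<close>
  define S where "S = {(a, b). \<exists>x\<in>X. f x y \<le> a \<and> f x z \<le> b}"
  have "convex S"
  proof (rule convexI)
    fix p q :: "real \<times> real" and u v :: real
    assume p: "p \<in> S" and q: "q \<in> S" and uv: "0 \<le> u" "0 \<le> v" "u + v = 1"
    obtain x x' where x: "x \<in> X" "f x y \<le> fst p" "f x z \<le> snd p"
      and x': "x' \<in> X" "f x' y \<le> fst q" "f x' z \<le> snd q"
      using p q by (auto simp: S_def)
    obtain x'' where x'': "x'' \<in> X" "f x'' y \<le> u * f x y + (1 - u) * f x' y"
      "f x'' z \<le> u * f x z + (1 - u) * f x' z"
      using convexlike[OF x(1) x'(1), of u] uv by auto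
    have v: "v = 1 - u" using uv by simp
    have "u * f x y + v * f x' y \<le> u * fst p + v * fst q"
      "u * f x z + v * f x' z \<le> u * snd p + v * snd q"
      using x x' uv by (auto intro!: add_mono mult_left_mono)
    then show "u *\<^sub>R p + v *\<^sub>R q \<in> S"
      unfolding S_def using x'' by (auto simp: v case_prod_beta intro!: bexI[of _ x''])
  qed
  moreover have "convex Q" unfolding Q_def by (intro convex_Times) auto
  moreover have "Q \<inter> S = {}"
    using x0(2) by (auto simp: Q_def S_def m_def[symmetric]) (smt (verit) max_def)
  moreover have "S \<noteq> {}" using False by (auto simp: S_def)
  moreover have "(m - 1, m - 1) \<in> Q" by (auto simp: Q_def)
  ultimately obtain a b where ab: "a \<noteq> 0" "\<forall>x\<in>Q. a \<bullet> x \<le> b" "\<forall>x\<in>S. b \<le> a \<bullet> x"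
    using separating_hyperplane_sets[of Q S] by blast
  obtain p q where a: "a = (p, q)" by fastforce
  have S: "b \<le> p * (f x y + r) + q * (f x z + s)" if "x \<in> X" "0 \<le> r" "0 \<le> s" for x r s
  proof -
    have "(f x y + r, f x z + s) \<in> S"
      using that by (auto simp: S_def intro!: bexI[of _ x])
    then show ?thesis using ab(3) by (auto simp: a)
  qed
  have Q: "p * r + q * s \<le> b" if "r < m" "s < m" for r s
    using ab(2) that by (auto simp: Q_def a)
  have "0 \<le> p"
  proof (rule ccontr)
    assume neg: "\<not> 0 \<le> p"
    \<comment> \<open>If p were negative, raising the first coordinate by this r would bring the
      linear functional down to at most b - 1, against its lower bound b on
      \<open>S\<close>.\<close>
    define r where "r = max 0 ((p * f x0 y + q * f x0 z - b + 1) / (- p))"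
    have "0 \<le> r" "(p * f x0 y + q * f x0 z - b + 1) / (- p) \<le> r"
      by (simp_all only: r_def max.cobounded1 max.cobounded2)
    then have "p * f x0 y + q * f x0 z - b + 1 \<le> r * (- p)"
      using neg by (subst (asm) pos_divide_le_eq) auto
    then show False using S[OF x0(1), of r 0] \<open>0 \<le> r\<close> by (simp add: algebra_simps)
  qed
  have "0 \<le> q"
  proof (rule ccontr)
    assume neg: "\<not> 0 \<le> q"
    define r where "r = max 0 ((p * f x0 y + q * f x0 z - b + 1) / (- q))"
    have "0 \<le> r" "(p * f x0 y + q * f x0 z - b + 1) / (- q) \<le> r"
      by (simp_all only: r_def max.cobounded1 max.cobounded2)
    then have "p * f x0 y + q * f x0 z - b + 1 \<le> r * (- q)"
      using neg by (subst (asm) pos_divide_le_eq) auto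
    then show False using S[OF x0(1), of 0 r] \<open>0 \<le> r\<close> by (simp add: algebra_simps)
  qed
  have pq: "0 < p + q" using \<open>0 \<le> p\<close> \<open>0 \<le> q\<close> ab(1) a by (auto simp: zero_prod_def)
  \<comment> \<open>The corner (m, m) lies only in the closure of \<open>Q\<close>, so it is
    approached along the diagonal.\<close>
  have "(p + q) * m \<le> b"
  proof (rule field_le_epsilon)
    fix e :: real assume "0 < e"
    define d where "d = e / (p + q)"
    have "p * (m - d) + q * (m - d) \<le> b"
      using pq \<open>0 < e\<close> by (intro Q) (auto simp: d_def)
    moreover have "(p + q) * d = e" using pq by (simp add: d_def)
    ultimately show "(p + q) * m \<le> b + e" by (simp add: algebra_simps)
  qed
  show ?thesis
  proof (intro bexI ballI)
    show "p / (p + q) \<in> {0..1}" using \<open>0 \<le> p\<close> \<open>0 \<le> q\<close> pq by auto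
    fix x assume "x \<in> X"
    then have "(p + q) * m \<le> p * f x y + q * f x z"
      using S[of x 0 0] \<open>(p + q) * m \<le> b\<close> by simp
    then have "m \<le> (p * f x y + q * f x z) / (p + q)"
      using pq by (simp add: pos_le_divide_eq mult.commute)
    also have "\<dots> = p / (p + q) * f x y + (1 - p / (p + q)) * f x z"
    proof -
      have "1 - p / (p + q) = q / (p + q)" using pq by (simp add: field_simps)
      then show ?thesis by (simp add: add_divide_distrib)
    qed
    finally show "c < p / (p + q) * f x y + (1 - p / (p + q)) * f x z"
      using \<open>c < m\<close> by simp
  qed
qed

text \<open>Induction on T: the part of X where z does not beat c is compact and stays convexlike,
  so the induction hypothesis yields one y that beats c there. Now y or z beats c at each point of
  X, some convex combination of the two does so everywhere, and concavelikeness replaces the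
  combination by an element of Y. The set S stays fixed while X shrinks, which keeps the concavelike
  hypothesis out of the induction.\<close>

lemma minimax_finite:
  fixes f :: "'a::topological_space \<Rightarrow> 'b \<Rightarrow> real"
  assumes "finite T" "T \<subseteq> Y" "T \<noteq> {}" "compact X"
    and "\<And>y. y \<in> Y \<Longrightarrow> continuous_on X (\<lambda>x. f x y)"
    and "\<And>x x' t. x \<in> X \<Longrightarrow> x' \<in> X \<Longrightarrow> 0 \<le> t \<Longrightarrow> t \<le> 1 \<Longrightarrow>
      \<exists>x''\<in>X. \<forall>y\<in>Y. f x'' y \<le> t * f x y + (1 - t) * f x' y"
    and concavelike: "\<And>y y' t. y \<in> Y \<Longrightarrow> y' \<in> Y \<Longrightarrow> 0 \<le> t \<Longrightarrow> t \<le> 1 \<Longrightarrow>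
      \<exists>y''\<in>Y. \<forall>x\<in>S. t * f x y + (1 - t) * f x y' \<le> f x y''"
    and "X \<subseteq> S"
    and "\<And>x. x \<in> X \<Longrightarrow> \<exists>y\<in>T. c < f x y"
  shows "\<exists>y\<in>Y. \<forall>x\<in>X. c < f x y"
  using assms(1,3,2,4,5,6,8,9)
proof (induction T arbitrary: X rule: finite_ne_induct)
  case (singleton y)
  from singleton.prems(6) have "\<forall>x\<in>X. c < f x y" by blast
  then show ?case using singleton.prems(1) by blast
next
  case (insert z T)
  define X' where "X' = {x \<in> X. f x z \<le> c}"
  have z: "z \<in> Y" using insert.prems by auto
  have "compact X'"
  proof -
    have "\<exists>A. closed A \<and> A \<inter> X = (\<lambda>x. f x z) -` {..c} \<inter> X"
      using insert.prems(3)[OF z] closed_atMost unfolding continuous_on_closed_invariant by blast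
    then obtain A where A: "closed A" "A \<inter> X = (\<lambda>x. f x z) -` {..c} \<inter> X"
      by blast
    have "X' = X \<inter> A" using A(2) by (auto simp: X'_def)
    then show ?thesis using A(1) insert.prems(2) by (simp add: compact_Int_closed)
  qed
  have "\<exists>y\<in>Y. \<forall>x\<in>X'. c < f x y"
  proof (rule insert.IH)
    show "T \<subseteq> Y" "compact X'" "X' \<subseteq> S" using insert.prems \<open>compact X'\<close> by (auto simp: X'_def)
    show "continuous_on X' (\<lambda>x. f x y)" if "y \<in> Y" for y
      using insert.prems(3)[OF that] by (rule continuous_on_subset) (auto simp: X'_def)
    show "\<exists>y\<in>T. c < f x y" if "x \<in> X'" for x
      using insert.prems(6)[of x] that by (auto simp: X'_def)
    fix x x' and t :: real
    assume xt: "x \<in> X'" "x' \<in> X'" "0 \<le> t" "t \<le> 1"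
    then obtain x'' where x'': "x'' \<in> X" "\<forall>y\<in>Y. f x'' y \<le> t * f x y + (1 - t) * f x' y"
      using insert.prems(4)[of x x' t] by (auto simp: X'_def)
    have "t * f x z + (1 - t) * f x' z \<le> t * c + (1 - t) * c"
      using xt by (intro add_mono mult_left_mono) (auto simp: X'_def)
    then have "f x'' z \<le> c" using x''(2) z by (force simp: algebra_simps)
    then show "\<exists>x''\<in>X'. \<forall>y\<in>Y. f x'' y \<le> t * f x y + (1 - t) * f x' y"
      using x'' by (auto simp: X'_def)
  qed
  then obtain y where y: "y \<in> Y" "\<forall>x\<in>X'. c < f x y" by blast
  have "\<exists>t\<in>{0..1}. \<forall>x\<in>X. c < t * f x y + (1 - t) * f x z"
  proof (rule minimax_two_points[OF insert.prems(2)])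
    show "continuous_on X (\<lambda>x. f x y)" "continuous_on X (\<lambda>x. f x z)"
      using insert.prems(3) y z by auto
    show "\<exists>x''\<in>X. \<forall>u\<in>{y, z}. f x'' u \<le> t * f x u + (1 - t) * f x' u"
      if "x \<in> X" "x' \<in> X" "0 \<le> t" "t \<le> 1" for x x' t
      using insert.prems(4)[OF that] y(1) z by blast
    show "c < f x y \<or> c < f x z" if "x \<in> X" for x
      using y(2) that by (force simp: X'_def)
  qed
  then obtain t where t: "0 \<le> t" "t \<le> 1" "\<forall>x\<in>X. c < t * f x y + (1 - t) * f x z" by auto
  with concavelike[OF y(1) z t(1,2)] insert.prems(5) show ?case
    by (meson less_le_trans subsetD)
qed

text \<open>Fan's minimax theorem, phrased at a level c: the relatively open sets on which a given y
  beats c cover X, and compactness leaves finitely many of them.\<close>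

lemma minimax_convexlike:
  fixes f :: "'a::topological_space \<Rightarrow> 'b \<Rightarrow> real"
  assumes "compact X" "Y \<noteq> {}"
    and cont: "\<And>y. y \<in> Y \<Longrightarrow> continuous_on X (\<lambda>x. f x y)"
    and convexlike: "\<And>x x' t. x \<in> X \<Longrightarrow> x' \<in> X \<Longrightarrow> 0 \<le> t \<Longrightarrow> t \<le> 1 \<Longrightarrow>
      \<exists>x''\<in>X. \<forall>y\<in>Y. f x'' y \<le> t * f x y + (1 - t) * f x' y"
    and concavelike: "\<And>y y' t. y \<in> Y \<Longrightarrow> y' \<in> Y \<Longrightarrow> 0 \<le> t \<Longrightarrow> t \<le> 1 \<Longrightarrow>
      \<exists>y''\<in>Y. \<forall>x\<in>X. t * f x y + (1 - t) * f x y' \<le> f x y''"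
    and above: "\<And>x. x \<in> X \<Longrightarrow> \<exists>y\<in>Y. c < f x y"
  shows "\<exists>y\<in>Y. \<forall>x\<in>X. c < f x y"
proof -
  have "\<forall>y\<in>Y. \<exists>A. open A \<and> A \<inter> X = (\<lambda>x. f x y) -` {c<..} \<inter> X"
    using cont open_greaterThan unfolding continuous_on_open_invariant by blast
  then obtain A where A: "\<And>y. y \<in> Y \<Longrightarrow> open (A y)"
      "\<And>y. y \<in> Y \<Longrightarrow> A y \<inter> X = (\<lambda>x. f x y) -` {c<..} \<inter> X"
    by metis
  have "X \<subseteq> (\<Union>y\<in>Y. A y)" using above A(2) by blast
  then obtain T where T: "T \<subseteq> Y" "finite T" "X \<subseteq> (\<Union>y\<in>T. A y)"
    using compactE_image[OF \<open>compact X\<close>, of Y A] A(1) by blast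
  show ?thesis
  proof (cases "T = {}")
    case True
    then show ?thesis using T(3) \<open>Y \<noteq> {}\<close> by auto
  next
    case False
    show ?thesis
    proof (rule minimax_finite[OF T(2,1) False \<open>compact X\<close> cont convexlike concavelike order_refl])
      show "\<exists>y\<in>T. c < f x y" if "x \<in> X" for x
        using T(1,3) A(2) that by blast
    qed
  qed
qed

text \<open>Z carries no convex structure of its own. It is replaced by the finitely supported
  probability weights on it; the payoff is affine in these, so concavelikeness holds with
  equality.\<close>

lemma minimax_weights:
  fixes g :: "'a::topological_space \<Rightarrow> 'b \<Rightarrow> real"
  assumes "compact X" "Z \<noteq> {}"
    and cont: "\<And>z. z \<in> Z \<Longrightarrow> continuous_on X (\<lambda>x. g x z)"
    and convexlike: "\<And>x x' t. x \<in> X \<Longrightarrow> x' \<in> X \<Longrightarrow> 0 \<le> t \<Longrightarrow> t \<le> 1 \<Longrightarrow>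
      \<exists>x''\<in>X. \<forall>z\<in>Z. g x'' z \<le> t * g x z + (1 - t) * g x' z"
    and above: "\<And>x. x \<in> X \<Longrightarrow> \<exists>z\<in>Z. c < g x z"
  obtains T w where "finite T" "T \<subseteq> Z" "\<And>z. z \<in> T \<Longrightarrow> 0 \<le> w z" "sum w T = 1"
    "\<And>x. x \<in> X \<Longrightarrow> c < (\<Sum>z\<in>T. w z * g x z)"
proof -
  define Y where "Y = {(T, w :: 'b \<Rightarrow> real). finite T \<and> T \<subseteq> Z \<and> (\<forall>z\<in>T. 0 \<le> w z) \<and> sum w T = 1}"
  define f where "f x y = (\<Sum>z\<in>fst y. snd y z * g x z)" for x and y :: "'b set \<times> ('b \<Rightarrow> real)"
  have single: "({z}, \<lambda>_. 1) \<in> Y" if "z \<in> Z" for z using that by (auto simp: Y_def)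
  have "\<exists>y\<in>Y. \<forall>x\<in>X. c < f x y"
  proof (rule minimax_convexlike[OF \<open>compact X\<close>])
    show "Y \<noteq> {}" using single \<open>Z \<noteq> {}\<close> by auto
    show "continuous_on X (\<lambda>x. f x y)" if "y \<in> Y" for y
      unfolding f_def using that cont by (intro continuous_on_sum continuous_on_mult continuous_on_const) (auto simp: Y_def)
    show "\<exists>y\<in>Y. c < f x y" if "x \<in> X" for x
    proof -
      obtain z where "z \<in> Z" "c < g x z" using above[OF \<open>x \<in> X\<close>] by blast
      then show ?thesis using single by (intro bexI[of _ "({z}, \<lambda>_. 1)"]) (auto simp: f_def)
    qed
    show "\<exists>x''\<in>X. \<forall>y\<in>Y. f x'' y \<le> t * f x y + (1 - t) * f x' y"
      if xt: "x \<in> X" "x' \<in> X" "0 \<le> t" "t \<le> 1" for x x' t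
    proof -
      obtain x'' where x'': "x'' \<in> X" "\<And>z. z \<in> Z \<Longrightarrow> g x'' z \<le> t * g x z + (1 - t) * g x' z"
        using convexlike[OF xt] by blast
      have "f x'' y \<le> t * f x y + (1 - t) * f x' y" if "y \<in> Y" for y
      proof -
        have "f x'' y \<le> (\<Sum>z\<in>fst y. snd y z * (t * g x z + (1 - t) * g x' z))"
          unfolding f_def using that x''(2) by (intro sum_mono mult_left_mono) (auto simp: Y_def)
        also have "\<dots> = t * f x y + (1 - t) * f x' y"
          by (simp add: f_def sum_distrib_left sum.distrib[symmetric] algebra_simps)
        finally show ?thesis .
      qed
      then show ?thesis using x''(1) by blast
    qed
    show "\<exists>y''\<in>Y. \<forall>x\<in>X. t * f x y + (1 - t) * f x y' \<le> f x y''"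
      if y: "y \<in> Y" and y': "y' \<in> Y" and t: "0 \<le> t" "t \<le> 1" for y y' t
    proof -
      obtain T w T' w' where eq: "y = (T, w)" "y' = (T', w')" by fastforce
      then have T: "finite T" "T \<subseteq> Z" "\<forall>z\<in>T. 0 \<le> w z" "sum w T = 1"
        and T': "finite T'" "T' \<subseteq> Z" "\<forall>z\<in>T'. 0 \<le> w' z" "sum w' T' = 1"
        using y y' by (auto simp: Y_def)
      \<comment> \<open>The conditionals cut w and w' down to T and T', since their values elsewhere
        are arbitrary.\<close>
      define v where "v z = t * (if z \<in> T then w z else 0) + (1 - t) * (if z \<in> T' then w' z else 0)" for z
      have sum_v: "(\<Sum>z\<in>T \<union> T'. v z * h z) = t * (\<Sum>z\<in>T. w z * h z) + (1 - t) * (\<Sum>z\<in>T'. w' z * h z)"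
        for h :: "'b \<Rightarrow> real"
      proof -
        have "(\<Sum>z\<in>T \<union> T'. v z * h z) = t * (\<Sum>z\<in>T \<union> T'. if z \<in> T then w z * h z else 0)
            + (1 - t) * (\<Sum>z\<in>T \<union> T'. if z \<in> T' then w' z * h z else 0)"
          unfolding sum_distrib_left sum.distrib[symmetric]
          by (intro sum.cong) (auto simp: v_def algebra_simps)
        also have "\<dots> = t * (\<Sum>z\<in>T. w z * h z) + (1 - t) * (\<Sum>z\<in>T'. w' z * h z)"
          using T(1) T'(1) by (simp add: sum.inter_restrict[symmetric] Int_absorb1)
        finally show ?thesis .
      qed
      have "0 \<le> v z" if "z \<in> T \<union> T'" for z
        using T(3) T'(3) t that by (auto simp: v_def)
      moreover have "sum v (T \<union> T') = 1" using sum_v[of "\<lambda>_. 1"] T T' by simp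
      ultimately have "(T \<union> T', v) \<in> Y" using T T' by (auto simp: Y_def)
      moreover have "t * f x y + (1 - t) * f x y' \<le> f x (T \<union> T', v)" for x
        using sum_v[of "g x"] by (simp add: f_def eq)
      ultimately show ?thesis by blast
    qed
  qed
  then obtain T w where "(T, w) \<in> Y" "\<forall>x\<in>X. c < f x (T, w)" by auto
  then show thesis using that[of T w] by (auto simp: Y_def f_def)
qed

section \<open>Increasing matrix paths\<close>

lemma psd_0 [simp]: "psd 0"
  by (simp add: psd_def sym_mat_def transpose_def vec_eq_iff)

lemma psd_add: "psd A \<Longrightarrow> psd B \<Longrightarrow> psd (A + B)"
  by (auto simp: psd_def sym_mat_def transpose_def vec_eq_iff matrix_vector_mult_add_rdistrib inner_add_right)

lemma psd_sum: "(\<And>i. i \<in> I \<Longrightarrow> psd (A i)) \<Longrightarrow> psd (\<Sum>i\<in>I. A i)"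
  by (induction I rule: infinite_finite_induct) (auto intro: psd_add)

lemma compact_psd_ball: "compact {A :: real^'n::finite^'n. psd A \<and> norm A \<le> 1}"
proof -
  have "{A :: real^'n^'n. psd A \<and> norm A \<le> 1} =
      cball 0 1 \<inter> ({A. transpose A = A} \<inter> (\<Inter>x. {A. 0 \<le> x \<bullet> (A *v x)}))"
    by (auto simp: psd_def sym_mat_def)
  moreover have "closed ({A :: real^'n^'n. transpose A = A} \<inter> (\<Inter>x. {A. 0 \<le> x \<bullet> (A *v x)}))"
    unfolding transpose_def vec_eq_iff matrix_vector_mult_def inner_vec_def
    by (intro closed_Int closed_INT ballI closed_Collect_le continuous_intros
        closed_Collect_all closed_Collect_eq)
  ultimately show ?thesis by (simp add: compact_Int_closed)
qed

text \<open>
  Sampling strictly to the right of \<open>u\<close> makes \<open>q (grid n u)\<close> converge to \<open>q u\<close> by right-continuity alone;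
  the minimum keeps the sample point below 1.
\<close>

definition grid :: "nat \<Rightarrow> real \<Rightarrow> real" where
  "grid n u = min ((of_int \<lfloor>real (Suc n) * u\<rfloor> + 1) / real (Suc n)) (1 - 1 / real (Suc n))"

lemma grid_bounds: "0 \<le> u \<Longrightarrow> 0 \<le> grid n u \<and> grid n u < 1"
  by (auto simp: grid_def min_less_iff_disj divide_simps)

lemma grid_tendsto_right:
  assumes "0 \<le> u" "u < 1"
  shows "filterlim (\<lambda>n. grid n u) (at_right u) sequentially"
proof -
  have ev: "eventually (\<lambda>n. 1 / real (Suc n) < 1 - u) sequentially"
    using assms lim_1_over_n[where 'a=real, THEN LIMSEQ_Suc]
    by (intro order_tendstoD(2)[of _ 0]) auto
  \<comment> \<open>Once 1/(n + 1) < 1 - u, both arguments of the minimum in \<open>grid\<close>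
    exceed u.\<close>
  have bnd: "u < grid n u \<and> grid n u \<le> u + 1 / real (Suc n)" if "1 / real (Suc n) < 1 - u" for n
  proof -
    have "real (Suc n) * u < of_int \<lfloor>real (Suc n) * u\<rfloor> + 1" by linarith
    moreover have "of_int \<lfloor>real (Suc n) * u\<rfloor> \<le> real (Suc n) * u" by linarith
    ultimately have "u < (of_int \<lfloor>real (Suc n) * u\<rfloor> + 1) / real (Suc n)"
      "(of_int \<lfloor>real (Suc n) * u\<rfloor> + 1) / real (Suc n) \<le> u + 1 / real (Suc n)"
      by (simp_all add: pos_less_divide_eq pos_divide_le_eq distrib_left mult.commute
          del: of_nat_Suc)
    then show ?thesis using that by (auto simp: grid_def)
  qed
  have "(\<lambda>n. grid n u) \<longlonglongrightarrow> u"
  proof (rule tendsto_sandwich[of "\<lambda>_. u" _ _ "\<lambda>n. u + 1 / real (Suc n)"])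
    show "(\<lambda>n. u + 1 / real (Suc n)) \<longlonglongrightarrow> u"
      using tendsto_add[OF tendsto_const lim_1_over_n[where 'a=real, THEN LIMSEQ_Suc], of u] by simp
  qed (use ev bnd in \<open>auto elim!: eventually_mono simp: less_imp_le\<close>)
  then show ?thesis
    unfolding filterlim_at using bnd by (auto intro!: eventually_mono[OF ev] dest!: bnd simp del: of_nat_Suc)
qed

lemma admissible_grid_tendsto:
  assumes "admissible_path q" "0 \<le> u" "u < 1"
  shows "(\<lambda>n. q (grid n u)) \<longlonglongrightarrow> q u"
proof -
  have "continuous (at_right u) q" using assms by (auto simp: admissible_path_def)
  then have "(q \<longlongrightarrow> q u) (at_right u)"
    by (simp add: continuous_within)
  then show ?thesis using grid_tendsto_right[OF assms(2,3)] by (rule filterlim_compose)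
qed

text \<open>After composition with \<open>grid n\<close>, the function q is evaluated through an
  integer, and every map out of a discrete space is measurable.\<close>

lemma measurable_compose_grid [measurable]:
  fixes q :: "real \<Rightarrow> 'b::topological_space"
  shows "(\<lambda>u. q (grid n u)) \<in> borel_measurable borel"
proof -
  have "(\<lambda>u. \<lfloor>real (Suc n) * u\<rfloor>) \<in> borel \<rightarrow>\<^sub>M count_space UNIV" by measurable
  then have "(\<lambda>u. (\<lambda>k::int. q (min ((of_int k + 1) / real (Suc n)) (1 - 1 / real (Suc n)))) \<lfloor>real (Suc n) * u\<rfloor>)
      \<in> borel_measurable borel"
    by (rule measurable_compose) simp
  then show ?thesis by (simp add: grid_def)
qed

lemma borel_measurable_lebesgue_on: "f \<in> borel_measurable borel \<Longrightarrow> f \<in> borel_measurable (lebesgue_on S)"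
  by (intro measurable_restrict_space1 measurable_completion) simp

lemma admissible_measurable:
  assumes "admissible_path q"
  shows "q \<in> borel_measurable (lebesgue_on {0..<1})"
proof (rule borel_measurable_LIMSEQ_metric)
  show "(\<lambda>u. q (grid n u)) \<in> borel_measurable (lebesgue_on {0..<1})" for n
    by (intro borel_measurable_lebesgue_on measurable_compose_grid)
  show "(\<lambda>n. q (grid n u)) \<longlonglongrightarrow> q u" if "u \<in> space (lebesgue_on {0..<1})" for u
    using that assms by (intro admissible_grid_tendsto) auto
qed

lemma prob_space_lebesgue_unit: "prob_space (lebesgue_on {0..<1::real})"
  by (intro prob_space_restrict_space) auto

section \<open>Step functions and step paths on the unit interval\<close>

lemma step_unit_interval:
  fixes c :: "nat \<Rightarrow> real"
  assumes "c 0 = 0" "c N = 1" "mono c" "0 \<le> u" "u < 1"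
  obtains k where "k < N" "c k \<le> u" "u < c (Suc k)"
proof -
  define k where "k = (LEAST k. u < c (Suc k))"
  have N: "N \<noteq> 0" using assms by (intro notI) auto
  then have ex: "u < c (Suc (N - 1))" using assms by simp
  then have "u < c (Suc k)" "k \<le> N - 1"
    unfolding k_def by (rule LeastI, intro Least_le)
  moreover have "c k \<le> u"
  proof (cases k)
    case (Suc j)
    then show ?thesis using not_less_Least[of j "\<lambda>k. u < c (Suc k)"] k_def by auto
  qed (use assms in auto)
  ultimately show ?thesis using that[of k] N by auto
qed

text \<open>Breakpoints may coincide: intervals of length zero correspond to points of weight
  zero.\<close>

lemma integral_step_function:
  fixes c :: "nat \<Rightarrow> real" and f :: "real \<Rightarrow> real"
  assumes c: "c 0 = 0" "c N = 1" "mono c"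
    and f: "\<And>k u. k < N \<Longrightarrow> c k \<le> u \<Longrightarrow> u < c (Suc k) \<Longrightarrow> f u = g k"
  shows "(LINT u|lebesgue_on {0..<1}. f u) = (\<Sum>k<N. (c (Suc k) - c k) * g k)"
proof -
  interpret prob_space "lebesgue_on {0..<1::real}" by (rule prob_space_lebesgue_unit)
  have mono: "c i \<le> c j" if "i \<le> j" for i j using c(3) that by (auto dest: monoD)
  have f_eq: "f u = (\<Sum>k<N. indicator {c k..<c (Suc k)} u * g k)" if u: "u \<in> {0..<1}" for u
  proof -
    obtain k where k: "k < N" "c k \<le> u" "u < c (Suc k)"
      using step_unit_interval[OF c, of u] u by auto
    have "(indicator {c j..<c (Suc j)} u :: real) = (if j = k then 1 else 0)" for j
    proof -
      have "j < k \<Longrightarrow> c (Suc j) \<le> c k" "k < j \<Longrightarrow> c (Suc k) \<le> c j" by (auto intro: mono)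
      then show ?thesis using k by (auto simp: indicator_def) (metis less_le_trans linorder_neqE_nat not_le order_trans)
    qed
    then have "(\<Sum>k<N. indicator {c k..<c (Suc k)} u * g k) = (\<Sum>j<N. if j = k then g k else 0)"
      by (intro sum.cong) auto
    then show ?thesis using k f by (simp add: sum.delta)
  qed
  have sub: "{c k..<c (Suc k)} \<subseteq> {0..<1}" if "k < N" for k
    using mono[of 0 k] mono[of "Suc k" N] that c by auto
  have sets: "{c k..<c (Suc k)} \<in> sets (lebesgue_on {0..<1})" if "k < N" for k
    using sub[OF that] by (auto simp: sets_restrict_space image_iff intro!: bexI[of _ "{c k..<c (Suc k)}"])
  have meas: "measure (lebesgue_on {0..<1}) {c k..<c (Suc k)} = c (Suc k) - c k" if "k < N" for k
    using sub[OF that] mono[of k "Suc k"] by (subst measure_restrict_space) auto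
  have "(LINT u|lebesgue_on {0..<1}. f u) =
      (LINT u|lebesgue_on {0..<1}. (\<Sum>k<N. indicator {c k..<c (Suc k)} u * g k))"
    by (intro Bochner_Integration.integral_cong) (auto simp: f_eq)
  also have "\<dots> = (\<Sum>k<N. (LINT u|lebesgue_on {0..<1}. indicator {c k..<c (Suc k)} u * g k))"
    by (intro Bochner_Integration.integral_sum integrable_mult_left)
      (auto intro!: integrable_real_indicator sets simp: less_top[symmetric])
  also have "\<dots> = (\<Sum>k<N. (c (Suc k) - c k) * g k)"
    using meas Int_absorb2[OF sub] by (intro sum.cong) (simp_all del: Int_atLeastLessThan)
  finally show ?thesis .
qed

text \<open>Every jump of a step path is a function of this form, and one-sided limits pass to
  finite sums.\<close>

lemma step_limits:
  fixes d :: "'a::real_normed_vector"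
  shows "((\<lambda>u. if c \<le> u then d else 0) \<longlongrightarrow> (if c \<le> u then d else 0)) (at_right (u::real))"
    and "((\<lambda>u. if c \<le> u then d else 0) \<longlongrightarrow> (if c < u then d else 0)) (at_left (u::real))"
proof -
  have "\<forall>\<^sub>F x in at_right u. (if c \<le> x then d else 0) = (if c \<le> u then d else 0)"
  proof (cases "c \<le> u")
    case True
    then show ?thesis by (auto simp: eventually_at_filter intro!: always_eventually)
  next
    case False
    then show ?thesis
      by (intro eventually_mono[OF eventually_at_right_real[of u c]]) auto
  qed
  then show "((\<lambda>u. if c \<le> u then d else 0) \<longlongrightarrow> (if c \<le> u then d else 0)) (at_right u)"
    by (rule tendsto_eventually)
  have "\<forall>\<^sub>F x in at_left u. (if c \<le> x then d else 0) = (if c < u then d else 0)"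
  proof (cases "c < u")
    case True
    then show ?thesis by (intro eventually_mono[OF eventually_at_left_real[of c u]]) auto
  next
    case False
    then show ?thesis by (auto simp: eventually_at_filter intro!: always_eventually)
  qed
  then show "((\<lambda>u. if c \<le> u then d else 0) \<longlongrightarrow> (if c < u then d else 0)) (at_left u)"
    by (rule tendsto_eventually)
qed

text \<open>The path is its initial value plus its jumps, each switched on at its breakpoint. In
  this form an increment is a sum of psd jumps, and the one-sided limits are those of single steps.
  The M + 1 values occupy the M + 1 intervals between \<open>c 0\<close> and
  \<open>c (Suc M)\<close>, some of which may be empty.\<close>

lemma admissible_step_path:
  fixes a :: "nat \<Rightarrow> real^'n::finite^'n" and c :: "nat \<Rightarrow> real"
  assumes a: "\<And>k. k \<le> M \<Longrightarrow> psd (a k) \<and> norm (a k) \<le> 1"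
    and incr: "\<And>k. k < M \<Longrightarrow> psd (a (Suc k) - a k)"
    and c: "c 0 = 0" "c (Suc M) = 1" "mono c"
  obtains q where "admissible_path q"
    and "\<And>k u. k \<le> M \<Longrightarrow> c k \<le> u \<Longrightarrow> u < c (Suc k) \<Longrightarrow> q u = a k"
proof -
  define q where "q u = a 0 + (\<Sum>k<M. if c (Suc k) \<le> u then a (Suc k) - a k else 0)" for u
  have mono: "c i \<le> c j" if "i \<le> j" for i j using c(3) that by (auto dest: monoD)
  have q: "q u = a k" if "k \<le> M" "c k \<le> u" "u < c (Suc k)" for k u
  proof -
    have "(\<Sum>j<M. if c (Suc j) \<le> u then a (Suc j) - a j else 0) = (\<Sum>j<k. a (Suc j) - a j)"
    proof (rule sum.mono_neutral_cong_right)
      show "\<forall>j\<in>{..<M} - {..<k}. (if c (Suc j) \<le> u then a (Suc j) - a j else 0) = 0"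
        using mono[of "Suc k" "Suc _"] that by (auto simp: not_less) (meson leD order_trans mono Suc_le_mono)
      show "(if c (Suc j) \<le> u then a (Suc j) - a j else 0) = a (Suc j) - a j" if "j \<in> {..<k}" for j
        using mono[of "Suc j" k] that \<open>c k \<le> u\<close> by auto
    qed (use that in auto)
    then show ?thesis by (simp add: q_def sum_lessThan_telescope)
  qed
  have "admissible_path q"
    unfolding admissible_path_def
  proof (intro conjI ballI impI)
    fix u :: real assume u: "u \<in> {0..<1}"
    obtain k where "k < Suc M" "c k \<le> u" "u < c (Suc k)"
      using step_unit_interval[OF c, of u] u by auto
    then show "psd (q u)" "norm (q u) \<le> 1" using q[of k u] a[of k] by auto
    show "continuous (at_right u) q"
      unfolding continuous_within q_def by (intro tendsto_add tendsto_const tendsto_sum step_limits)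
  next
    fix u v :: real assume "u \<le> v"
    have "q v - q u = (\<Sum>k<M. (if c (Suc k) \<le> v then a (Suc k) - a k else 0)
        - (if c (Suc k) \<le> u then a (Suc k) - a k else 0))"
      by (simp add: q_def sum_subtractf)
    also have "psd \<dots>" using incr \<open>u \<le> v\<close> by (intro psd_sum) auto
    finally show "psd (q v - q u)" .
  next
    fix u :: real
    show "\<exists>l. (q \<longlongrightarrow> l) (at_left u)"
      unfolding q_def
      by (rule exI) (rule tendsto_add[OF tendsto_const tendsto_sum[OF step_limits(2)]])
  qed
  then show ?thesis using that q by blast
qed

section \<open>Lipschitz functions on the gradient image\<close>

lemma abs_convex_bound_le:
  fixes a b c t :: real
  assumes t: "0 \<le> t" "t \<le> 1" and "\<bar>a\<bar> \<le> c" "\<bar>b\<bar> \<le> c"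
  shows "\<bar>t * a + (1 - t) * b\<bar> \<le> c"
proof -
  have "\<bar>t * a + (1 - t) * b\<bar> \<le> t * \<bar>a\<bar> + (1 - t) * \<bar>b\<bar>"
    using t by (intro order_trans[OF abs_triangle_ineq]) (simp add: abs_mult)
  also have "\<dots> \<le> c" using assms by (intro convex_bound_le) auto
  finally show ?thesis .
qed

locale smooth_potential =
  fixes \<xi> :: "real^'n::finite^'n \<Rightarrow> real"
  assumes smooth: "smooth_fun \<xi>"
begin

section \<open>The gradient and its compact image\<close>

lemma GDERIV_grad: "GDERIV \<xi> x :> grad \<xi> x"
proof -
  have "\<xi> differentiable (at x)" using smooth by (cases rule: smooth_fun.cases) auto
  then have D: "(\<xi> has_derivative frechet_derivative \<xi> (at x)) (at x)"
    by (simp add: frechet_derivative_works)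
  let ?D = "frechet_derivative \<xi> (at x)"
  have "linear ?D" using D has_derivative_linear by blast
  then have "?D h = h \<bullet> (\<Sum>b\<in>Basis. ?D b *\<^sub>R b)" for h
  proof -
    have "?D h = ?D (\<Sum>b\<in>Basis. (h \<bullet> b) *\<^sub>R b)" by (simp add: euclidean_representation)
    also have "\<dots> = (\<Sum>b\<in>Basis. (h \<bullet> b) * ?D b)"
      using \<open>linear ?D\<close> by (simp add: linear_sum linear_cmul)
    finally show ?thesis by (simp add: inner_sum_right mult.commute)
  qed
  then have "?D = (\<lambda>h. h \<bullet> (\<Sum>b\<in>Basis. ?D b *\<^sub>R b))" by blast
  then have "GDERIV \<xi> x :> (\<Sum>b\<in>Basis. ?D b *\<^sub>R b)"
    unfolding gderiv_def using D by metis
  then show ?thesis unfolding grad_def by (rule someI)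
qed

text \<open>The second unfolding of \<open>smooth_fun\<close> enters here: each directional
  derivative is itself differentiable, hence continuous.\<close>

lemma continuous_grad: "continuous_on S (grad \<xi>)"
proof -
  have eq: "grad \<xi> x \<bullet> v = frechet_derivative \<xi> (at x) v" for x v
    using frechet_derivative_at[OF GDERIV_grad[of x, unfolded gderiv_def]]
    by (metis inner_commute)
  have "smooth_fun (\<lambda>x. frechet_derivative \<xi> (at x) v)" for v
    using smooth by (cases rule: smooth_fun.cases) auto
  then have "(\<lambda>x. frechet_derivative \<xi> (at x) v) differentiable (at x)" for x v
    by (cases rule: smooth_fun.cases) auto
  then have "continuous_on S (\<lambda>x. grad \<xi> x \<bullet> v)" for v
    unfolding eq
    by (intro continuous_at_imp_continuous_on ballI differentiable_imp_continuous_within)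
  then have "continuous_on S (\<lambda>x. \<Sum>b\<in>Basis. (grad \<xi> x \<bullet> b) *\<^sub>R b)"
    by (intro continuous_on_sum continuous_on_scaleR continuous_on_const)
  then show ?thesis by (simp add: euclidean_representation)
qed

lemma compact_Kxi: "compact (Kxi \<xi>)"
  unfolding Kxi_def by (intro compact_continuous_image continuous_grad compact_psd_ball)

lemma x0_in_Kxi: "x0 \<xi> \<in> Kxi \<xi>"
  by (auto simp: x0_def Kxi_def intro!: imageI)

text \<open>The 1 is the bound at \<open>x0\<close> in the Lipschitz ball and the diameter bounds
  the oscillation, so the sum bounds every function of the ball on K.\<close>

definition Kbound :: real where "Kbound = 1 + diameter (Kxi \<xi>)"

lemma dist_le_Kbound: "x \<in> Kxi \<xi> \<Longrightarrow> y \<in> Kxi \<xi> \<Longrightarrow> dist x y \<le> Kbound"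
  using diameter_bounded_bound[OF compact_imp_bounded[OF compact_Kxi], of x y]
  by (simp add: Kbound_def)

lemma Lip_ball_bounded: "ch \<in> Lip_ball \<xi> \<Longrightarrow> x \<in> Kxi \<xi> \<Longrightarrow> \<bar>ch x\<bar> \<le> Kbound"
proof -
  assume ch: "ch \<in> Lip_ball \<xi>" and x: "x \<in> Kxi \<xi>"
  have "\<bar>ch x - ch (x0 \<xi>)\<bar> \<le> dist x (x0 \<xi>)" "\<bar>ch (x0 \<xi>)\<bar> \<le> 1"
    using ch x x0_in_Kxi by (auto simp: Lip_ball_def)
  then show ?thesis
    using diameter_bounded_bound[OF compact_imp_bounded[OF compact_Kxi] x x0_in_Kxi]
    by (simp add: Kbound_def)
qed

lemma Lip_measurable:
  assumes "\<And>x y. x \<in> Kxi \<xi> \<Longrightarrow> y \<in> Kxi \<xi> \<Longrightarrow> \<bar>ch x - ch y :: real\<bar> \<le> C * dist x y"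
  shows "ch \<in> borel_measurable (Kspace \<xi>)"
proof -
  have "(max 0 C)-lipschitz_on (Kxi \<xi>) ch"
    using assms
    by (intro lipschitz_onI) (auto simp: dist_real_def intro: order_trans[OF _ mult_right_mono[of C "max 0 C"]])
  then show ?thesis
    by (intro borel_measurable_continuous_on_restrict lipschitz_on_continuous_on)
qed

lemma Lip_ball_measurable: "ch \<in> Lip_ball \<xi> \<Longrightarrow> ch \<in> borel_measurable (Kspace \<xi>)"
  by (rule Lip_measurable[of _ 1]) (auto simp: Lip_ball_def)

lemma Lip_ball_zero: "(\<lambda>_. 0) \<in> Lip_ball \<xi>"
  by (auto simp: Lip_ball_def)

lemma Lip_ball_uminus: "ch \<in> Lip_ball \<xi> \<Longrightarrow> (\<lambda>x. - ch x) \<in> Lip_ball \<xi>"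
  by (auto simp: Lip_ball_def) (metis abs_minus_commute)

lemma Lip_ball_mix:
  assumes ch: "ch \<in> Lip_ball \<xi>" "ch' \<in> Lip_ball \<xi>" and t: "0 \<le> t" "t \<le> 1"
  shows "(\<lambda>x. t * ch x + (1 - t) * ch' x) \<in> Lip_ball \<xi>"
proof -
  have "\<bar>(t * ch x + (1 - t) * ch' x) - (t * ch y + (1 - t) * ch' y)\<bar> \<le> dist x y"
    if "x \<in> Kxi \<xi>" "y \<in> Kxi \<xi>" for x y
    using abs_convex_bound_le[OF t, of "ch x - ch y" "dist x y" "ch' x - ch' y"] ch that
    by (auto simp: Lip_ball_def algebra_simps)
  then show ?thesis using abs_convex_bound_le[OF t] ch by (auto simp: Lip_ball_def)
qed

text \<open>Any 1-Lipschitz function on K can thus be tested; its integral against a probability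
  measure changes only by the subtracted constant.\<close>

lemma Lip_ball_shift:
  assumes "\<And>x y. x \<in> Kxi \<xi> \<Longrightarrow> y \<in> Kxi \<xi> \<Longrightarrow> \<bar>ch x - ch y\<bar> \<le> dist x y"
  shows "(\<lambda>x. ch x - ch (x0 \<xi>)) \<in> Lip_ball \<xi>"
  using assms by (auto simp: Lip_ball_def)

lemma finite_K_integrable:
  assumes "finite_K_measure \<xi> \<nu>" "f \<in> borel_measurable (Kspace \<xi>)"
    and "\<And>x. x \<in> Kxi \<xi> \<Longrightarrow> \<bar>f x\<bar> \<le> (B::real)"
  shows "integrable \<nu> f"
proof -
  interpret finite_measure \<nu> using assms by (simp add: finite_K_measure_def)
  have "f \<in> borel_measurable \<nu>"
    using assms by (simp add: finite_K_measure_def cong: measurable_cong_sets)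
  then show ?thesis
    using assms by (intro integrable_const_bound[of _ B]) (auto simp: finite_K_measure_def intro!: AE_I2)
qed

lemma Lip_ball_integrable: "finite_K_measure \<xi> \<nu> \<Longrightarrow> ch \<in> Lip_ball \<xi> \<Longrightarrow> integrable \<nu> ch"
  by (rule finite_K_integrable[OF _ Lip_ball_measurable Lip_ball_bounded])

lemma finite_K_integral_close:
  assumes \<nu>: "finite_K_measure \<xi> \<nu>" and int: "integrable \<nu> f" "integrable \<nu> g"
    and "\<And>x. x \<in> Kxi \<xi> \<Longrightarrow> \<bar>f x - g x\<bar> \<le> (e::real)"
  shows "\<bar>integral\<^sup>L \<nu> f - integral\<^sup>L \<nu> g\<bar> \<le> e * measure \<nu> (Kxi \<xi>)"
proof -
  interpret finite_measure \<nu> using \<nu> by (simp add: finite_K_measure_def)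
  have sp: "space \<nu> = Kxi \<xi>" using \<nu> by (simp add: finite_K_measure_def)
  have "\<bar>integral\<^sup>L \<nu> f - integral\<^sup>L \<nu> g\<bar> = \<bar>\<integral>x. f x - g x \<partial>\<nu>\<bar>" using int by simp
  also have "\<dots> \<le> (\<integral>x. \<bar>f x - g x\<bar> \<partial>\<nu>)" by (rule integral_abs_bound)
  also have "\<dots> \<le> (\<integral>x. e \<partial>\<nu>)"
    using int assms(4) sp by (intro integral_mono) auto
  also have "\<dots> = e * measure \<nu> (Kxi \<xi>)" by (simp add: sp)
  finally show ?thesis .
qed

section \<open>Functionals on the Lipschitz ball\<close>

lemma M1_approx:
  assumes "F \<in> M1 \<xi>" "0 < e"
  obtains \<nu>1 \<nu>2 where "finite_K_measure \<xi> \<nu>1" "finite_K_measure \<xi> \<nu>2"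
    "\<And>ch. ch \<in> Lip_ball \<xi> \<Longrightarrow> \<bar>F ch - (integral\<^sup>L \<nu>1 ch - integral\<^sup>L \<nu>2 ch)\<bar> \<le> e"
  using assms unfolding M1_def by blast

text \<open>Elements of \<open>M1\<close> are known only through uniform approximation on the ball,
  so affinity is a limit of the linearity of integrals: the error e/2 at the mixture and the
  averaged errors e/2 add up to e.\<close>

lemma M1_mix:
  assumes F: "F \<in> M1 \<xi>" and ch: "ch \<in> Lip_ball \<xi>" "ch' \<in> Lip_ball \<xi>" and t: "0 \<le> t" "t \<le> 1"
  shows "F (\<lambda>x. t * ch x + (1 - t) * ch' x) = t * F ch + (1 - t) * F ch'"
proof -
  let ?m = "\<lambda>x. t * ch x + (1 - t) * ch' x"
  have "\<bar>F ?m - (t * F ch + (1 - t) * F ch')\<bar> \<le> 0 + e" if "0 < e" for e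
  proof -
    from that have "0 < e / 2" by simp
    then obtain \<nu>1 \<nu>2 where \<nu>: "finite_K_measure \<xi> \<nu>1" "finite_K_measure \<xi> \<nu>2"
      and close: "\<And>ch. ch \<in> Lip_ball \<xi> \<Longrightarrow> \<bar>F ch - (integral\<^sup>L \<nu>1 ch - integral\<^sup>L \<nu>2 ch)\<bar> \<le> e / 2"
      using M1_approx[OF F] by blast
    define I where "I ch = integral\<^sup>L \<nu>1 ch - integral\<^sup>L \<nu>2 ch" for ch :: "real^'n^'n \<Rightarrow> real"
    have "I ?m = t * I ch + (1 - t) * I ch'"
      using \<nu> ch by (simp add: I_def Lip_ball_integrable algebra_simps)
    then have "F ?m - (t * F ch + (1 - t) * F ch') =
        (F ?m - I ?m) - (t * (F ch - I ch) + (1 - t) * (F ch' - I ch'))"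
      by (simp add: algebra_simps)
    moreover have "\<bar>F ?m - I ?m\<bar> \<le> e / 2"
      using close[OF Lip_ball_mix[OF ch t]] by (simp add: I_def)
    moreover have "t * (F ch - I ch) + (1 - t) * (F ch' - I ch') \<le> t * (e / 2) + (1 - t) * (e / 2)"
      "t * (- (e / 2)) + (1 - t) * (- (e / 2)) \<le> t * (F ch - I ch) + (1 - t) * (F ch' - I ch')"
      using t close[OF ch(1)] close[OF ch(2)]
      by (intro add_mono mult_left_mono; simp add: I_def abs_le_iff; linarith)+
    moreover have cmb: "t * a + (1 - t) * a = a" for a by (simp add: algebra_simps)
    ultimately show ?thesis using cmb[of "e / 2"] cmb[of "- (e / 2)"] by linarith
  qed
  then have "\<bar>F ?m - (t * F ch + (1 - t) * F ch')\<bar> \<le> 0" by (rule field_le_epsilon)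
  then show ?thesis by simp
qed

lemma M1_uniformly_continuous:
  assumes F: "F \<in> M1 \<xi>" and "0 < e"
  obtains d where "0 < d" "\<And>ch ch'. ch \<in> Lip_ball \<xi> \<Longrightarrow> ch' \<in> Lip_ball \<xi> \<Longrightarrow>
    (\<And>x. x \<in> Kxi \<xi> \<Longrightarrow> \<bar>ch x - ch' x\<bar> \<le> d) \<Longrightarrow> \<bar>F ch - F ch'\<bar> \<le> e"
proof -
  from \<open>0 < e\<close> have "0 < e / 4" by simp
  then obtain \<nu>1 \<nu>2 where \<nu>: "finite_K_measure \<xi> \<nu>1" "finite_K_measure \<xi> \<nu>2"
    and close: "\<And>ch. ch \<in> Lip_ball \<xi> \<Longrightarrow> \<bar>F ch - (integral\<^sup>L \<nu>1 ch - integral\<^sup>L \<nu>2 ch)\<bar> \<le> e / 4"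
    using M1_approx[OF F] by blast
  define C where "C = measure \<nu>1 (Kxi \<xi>) + measure \<nu>2 (Kxi \<xi>)"
  \<comment> \<open>The two integrals together change by at most d * C, which is at most e/2; the
    approximation error e/4 is paid twice. Adding 1 to C guards against total mass zero.\<close>
  define d where "d = e / 2 / (C + 1)"
  have "0 \<le> C" by (simp add: C_def)
  then have "0 < d" using \<open>0 < e\<close> by (simp add: d_def)
  have dC: "d * C \<le> e / 2" using \<open>0 \<le> C\<close> \<open>0 < e\<close> by (simp add: d_def field_simps)
  show thesis
  proof (rule that[OF \<open>0 < d\<close>])
    fix ch ch' assume ch: "ch \<in> Lip_ball \<xi>" "ch' \<in> Lip_ball \<xi>"
      and cl: "\<And>x. x \<in> Kxi \<xi> \<Longrightarrow> \<bar>ch x - ch' x\<bar> \<le> d"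
    have "\<bar>integral\<^sup>L \<nu>1 ch - integral\<^sup>L \<nu>1 ch'\<bar> \<le> d * measure \<nu>1 (Kxi \<xi>)"
      "\<bar>integral\<^sup>L \<nu>2 ch - integral\<^sup>L \<nu>2 ch'\<bar> \<le> d * measure \<nu>2 (Kxi \<xi>)"
      using \<nu> ch cl by (auto intro!: finite_K_integral_close Lip_ball_integrable)
    moreover have "d * measure \<nu>1 (Kxi \<xi>) + d * measure \<nu>2 (Kxi \<xi>) \<le> e / 2"
      using dC by (simp add: C_def distrib_left)
    ultimately show "\<bar>F ch - F ch'\<bar> \<le> e" using close[OF ch(1)] close[OF ch(2)] by linarith
  qed
qed

lemma M1_zero: "F \<in> M1 \<xi> \<Longrightarrow> F (\<lambda>_. 0) = 0"
proof -
  assume F: "F \<in> M1 \<xi>"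
  have "\<bar>F (\<lambda>_. 0)\<bar> \<le> 0 + e" if "0 < e" for e
    using M1_approx[OF F that] Lip_ball_zero by (metis add_0 diff_zero integral_zero)
  then have "\<bar>F (\<lambda>_. 0)\<bar> \<le> 0" by (rule field_le_epsilon)
  then show ?thesis by simp
qed

lemma M1_bounded:
  assumes F: "F \<in> M1 \<xi>"
  obtains B where "\<And>ch. ch \<in> Lip_ball \<xi> \<Longrightarrow> \<bar>F ch\<bar> \<le> B"
proof -
  obtain \<nu>1 \<nu>2 where \<nu>: "finite_K_measure \<xi> \<nu>1" "finite_K_measure \<xi> \<nu>2"
    and close: "\<And>ch. ch \<in> Lip_ball \<xi> \<Longrightarrow> \<bar>F ch - (integral\<^sup>L \<nu>1 ch - integral\<^sup>L \<nu>2 ch)\<bar> \<le> 1"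
    using M1_approx[OF F zero_less_one] by blast
  have "\<bar>F ch\<bar> \<le> 1 + Kbound * measure \<nu>1 (Kxi \<xi>) + Kbound * measure \<nu>2 (Kxi \<xi>)"
    if ch: "ch \<in> Lip_ball \<xi>" for ch
    using close[OF ch] finite_K_integral_close[OF \<nu>(1) Lip_ball_integrable[OF \<nu>(1) ch], of "\<lambda>_. 0" Kbound]
      finite_K_integral_close[OF \<nu>(2) Lip_ball_integrable[OF \<nu>(2) ch], of "\<lambda>_. 0" Kbound]
      Lip_ball_bounded[OF ch] by simp
  then show thesis by (rule that)
qed

lemma emb_in_M1: "finite_K_measure \<xi> \<nu> \<Longrightarrow> emb \<nu> \<in> M1 \<xi>"
proof -
  assume \<nu>: "finite_K_measure \<xi> \<nu>"
  have "finite_K_measure \<xi> (null_measure (Kspace \<xi>))"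
    by (auto simp: finite_K_measure_def space_restrict_space intro!: finite_measureI)
  then show ?thesis
    using \<nu> unfolding M1_def emb_def
    by (intro CollectI allI impI exI[of _ \<nu>] exI[of _ "null_measure (Kspace \<xi>)"]) auto
qed

text \<open>
  \<open>M1\<close> is replaced by this larger set because its closure under convex combinations does not require
  adding measures.
\<close>

definition Lip_functionals :: "'n mfun set" where
  "Lip_functionals = {F. F (\<lambda>_. 0) = 0 \<and>
    (\<exists>B. \<forall>ch\<in>Lip_ball \<xi>. \<bar>F ch\<bar> \<le> B) \<and>
    (\<forall>ch\<in>Lip_ball \<xi>. \<forall>ch'\<in>Lip_ball \<xi>. \<forall>t. 0 \<le> t \<and> t \<le> 1 \<longrightarrow>
      F (\<lambda>x. t * ch x + (1 - t) * ch' x) = t * F ch + (1 - t) * F ch') \<and>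
    (\<forall>e>0. \<exists>d>0. \<forall>ch\<in>Lip_ball \<xi>. \<forall>ch'\<in>Lip_ball \<xi>.
      (\<forall>x\<in>Kxi \<xi>. \<bar>ch x - ch' x\<bar> \<le> d) \<longrightarrow> \<bar>F ch - F ch'\<bar> \<le> e)}"

lemma M1_subset_Lip_functionals: "M1 \<xi> \<subseteq> Lip_functionals"
proof
  fix F assume F: "F \<in> M1 \<xi>"
  have "\<exists>d>0. \<forall>ch\<in>Lip_ball \<xi>. \<forall>ch'\<in>Lip_ball \<xi>.
      (\<forall>x\<in>Kxi \<xi>. \<bar>ch x - ch' x\<bar> \<le> d) \<longrightarrow> \<bar>F ch - F ch'\<bar> \<le> e" if "0 < e" for e
    using M1_uniformly_continuous[OF F that] by metis
  moreover have "\<exists>B. \<forall>ch\<in>Lip_ball \<xi>. \<bar>F ch\<bar> \<le> B" using M1_bounded[OF F] by metis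
  ultimately show "F \<in> Lip_functionals"
    unfolding Lip_functionals_def using M1_zero[OF F] M1_mix[OF F] by blast
qed

lemma Lip_functionals_mix:
  assumes F: "F \<in> Lip_functionals" and ch: "ch \<in> Lip_ball \<xi>" "ch' \<in> Lip_ball \<xi>"
    and t: "0 \<le> t" "t \<le> 1"
  shows "F (\<lambda>x. t * ch x + (1 - t) * ch' x) = t * F ch + (1 - t) * F ch'"
  using assms by (simp add: Lip_functionals_def)

lemma Lip_functionals_modulus:
  assumes "F \<in> Lip_functionals" "0 < e"
  shows "\<exists>d>0. \<forall>ch\<in>Lip_ball \<xi>. \<forall>ch'\<in>Lip_ball \<xi>.
    (\<forall>x\<in>Kxi \<xi>. \<bar>ch x - ch' x\<bar> \<le> d) \<longrightarrow> \<bar>F ch - F ch'\<bar> \<le> e"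
  using assms by (simp add: Lip_functionals_def)

lemma Lip_functionals_bounded:
  "F \<in> Lip_functionals \<Longrightarrow> \<exists>B. \<forall>ch\<in>Lip_ball \<xi>. \<bar>F ch\<bar> \<le> B"
  by (simp add: Lip_functionals_def)

lemma Lip_functionals_convex:
  assumes F: "F \<in> Lip_functionals" and G: "G \<in> Lip_functionals" and t: "0 \<le> t" "t \<le> 1"
  shows "(\<lambda>ch. t * F ch + (1 - t) * G ch) \<in> Lip_functionals"
proof -
  let ?H = "\<lambda>ch. t * F ch + (1 - t) * G ch"
  obtain B B' where B: "\<forall>ch\<in>Lip_ball \<xi>. \<bar>F ch\<bar> \<le> B" "\<forall>ch\<in>Lip_ball \<xi>. \<bar>G ch\<bar> \<le> B'"
    using Lip_functionals_bounded[OF F] Lip_functionals_bounded[OF G] by blast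
  have "\<bar>?H ch\<bar> \<le> max B B'" if "ch \<in> Lip_ball \<xi>" for ch
    using B that by (intro abs_convex_bound_le[OF t]) force+
  moreover have "\<exists>d>0. \<forall>ch\<in>Lip_ball \<xi>. \<forall>ch'\<in>Lip_ball \<xi>.
      (\<forall>x\<in>Kxi \<xi>. \<bar>ch x - ch' x\<bar> \<le> d) \<longrightarrow> \<bar>?H ch - ?H ch'\<bar> \<le> e" if "0 < e" for e
  proof -
    obtain d d' where d: "0 < d" "\<forall>ch\<in>Lip_ball \<xi>. \<forall>ch'\<in>Lip_ball \<xi>.
        (\<forall>x\<in>Kxi \<xi>. \<bar>ch x - ch' x\<bar> \<le> d) \<longrightarrow> \<bar>F ch - F ch'\<bar> \<le> e"
      and d': "0 < d'" "\<forall>ch\<in>Lip_ball \<xi>. \<forall>ch'\<in>Lip_ball \<xi>.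
        (\<forall>x\<in>Kxi \<xi>. \<bar>ch x - ch' x\<bar> \<le> d') \<longrightarrow> \<bar>G ch - G ch'\<bar> \<le> e"
      using Lip_functionals_modulus[OF F \<open>0 < e\<close>] Lip_functionals_modulus[OF G \<open>0 < e\<close>] by blast
    have "\<bar>?H ch - ?H ch'\<bar> \<le> e" if ch: "ch \<in> Lip_ball \<xi>" "ch' \<in> Lip_ball \<xi>"
      and "\<forall>x\<in>Kxi \<xi>. \<bar>ch x - ch' x\<bar> \<le> min d d'" for ch ch'
    proof -
      have "\<bar>t * (F ch - F ch') + (1 - t) * (G ch - G ch')\<bar> \<le> e"
        using d(2) d'(2) that by (intro abs_convex_bound_le[OF t]) auto
      then show ?thesis by (simp add: algebra_simps)
    qed
    then show ?thesis using d(1) d'(1) by (intro exI[of _ "min d d'"]) auto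
  qed
  moreover have "?H (\<lambda>x. s * ch x + (1 - s) * ch' x) = s * ?H ch + (1 - s) * ?H ch'"
    if "ch \<in> Lip_ball \<xi>" "ch' \<in> Lip_ball \<xi>" "0 \<le> s" "s \<le> 1" for ch ch' s
    unfolding Lip_functionals_mix[OF F that] Lip_functionals_mix[OF G that]
    by (simp add: algebra_simps)
  moreover have "?H (\<lambda>_. 0) = 0" using F G by (simp add: Lip_functionals_def)
  ultimately show ?thesis
    unfolding Lip_functionals_def by blast
qed

text \<open>The modulus of continuity compares functions on K only, so F cannot tell apart two
  functions that agree there.\<close>

lemma Lip_functionals_cong:
  assumes F: "F \<in> Lip_functionals" and ch: "ch \<in> Lip_ball \<xi>" "ch' \<in> Lip_ball \<xi>"
    and eq: "\<And>x. x \<in> Kxi \<xi> \<Longrightarrow> ch x = ch' x"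
  shows "F ch = F ch'"
proof -
  have "\<bar>F ch - F ch'\<bar> \<le> 0 + e" if "0 < e" for e
  proof -
    obtain d where "d > 0" "\<forall>ch\<in>Lip_ball \<xi>. \<forall>ch'\<in>Lip_ball \<xi>.
        (\<forall>x\<in>Kxi \<xi>. \<bar>ch x - ch' x\<bar> \<le> d) \<longrightarrow> \<bar>F ch - F ch'\<bar> \<le> e"
      using Lip_functionals_modulus[OF F \<open>0 < e\<close>] by blast
    then show ?thesis using ch eq by auto
  qed
  then have "\<bar>F ch - F ch'\<bar> \<le> 0" by (rule field_le_epsilon)
  then show ?thesis by simp
qed

text \<open>Zero is the midpoint of \<open>ch\<close> and its negative, and F is affine with value 0
  there.\<close>

lemma Lip_functionals_uminus:
  assumes F: "F \<in> Lip_functionals" and ch: "ch \<in> Lip_ball \<xi>"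
  shows "F (\<lambda>x. - ch x) = - F ch"
  using Lip_functionals_mix[OF F ch Lip_ball_uminus[OF ch], of "1/2"] F
  by (simp add: Lip_functionals_def)

text \<open>\<open>dM\<close> is a supremum of reals and carries its intended meaning only once the
  set is known to be bounded.\<close>

lemma dM_bdd: "F \<in> Lip_functionals \<Longrightarrow> G \<in> Lip_functionals \<Longrightarrow> bdd_above ((\<lambda>ch. F ch - G ch) ` Lip_ball \<xi>)"
proof -
  assume F: "F \<in> Lip_functionals" and G: "G \<in> Lip_functionals"
  obtain B B' where "\<forall>ch\<in>Lip_ball \<xi>. \<bar>F ch\<bar> \<le> B" "\<forall>ch\<in>Lip_ball \<xi>. \<bar>G ch\<bar> \<le> B'"
    using Lip_functionals_bounded[OF F] Lip_functionals_bounded[OF G] by blast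
  then show ?thesis by (intro bdd_aboveI2[of _ _ "B + B'"]) (smt (verit))
qed

lemma dM_upper: "F \<in> Lip_functionals \<Longrightarrow> G \<in> Lip_functionals \<Longrightarrow> ch \<in> Lip_ball \<xi> \<Longrightarrow> F ch - G ch \<le> dM \<xi> F G"
  unfolding dM_def by (intro cSUP_upper dM_bdd)

lemma dM_least: "(\<And>ch. ch \<in> Lip_ball \<xi> \<Longrightarrow> F ch - G ch \<le> D) \<Longrightarrow> dM \<xi> F G \<le> D"
  unfolding dM_def using Lip_ball_zero by (intro cSUP_least) auto

lemma dM_commute: "F \<in> Lip_functionals \<Longrightarrow> G \<in> Lip_functionals \<Longrightarrow> dM \<xi> F G = dM \<xi> G F"
proof -
  have "dM \<xi> F G \<le> dM \<xi> G F" if "F \<in> Lip_functionals" "G \<in> Lip_functionals" for F G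
  proof (rule dM_least)
    fix ch assume ch: "ch \<in> Lip_ball \<xi>"
    show "F ch - G ch \<le> dM \<xi> G F"
      using dM_upper[OF that(2,1) Lip_ball_uminus[OF ch]] that ch
      by (simp add: Lip_functionals_uminus)
  qed
  then show "F \<in> Lip_functionals \<Longrightarrow> G \<in> Lip_functionals \<Longrightarrow> ?thesis" by (intro antisym)
qed

text \<open>Only the values on \<open>K\<close> matter; fixing them elsewhere makes the set compact by Tychonoff.\<close>

definition Lip0 :: "(real^'n^'n \<Rightarrow> real) set" where
  "Lip0 = {ch \<in> Lip_ball \<xi>. \<forall>x. x \<notin> Kxi \<xi> \<longrightarrow> ch x = 0}"

lemma Lip0_restrict: "ch \<in> Lip_ball \<xi> \<Longrightarrow> (\<lambda>x. if x \<in> Kxi \<xi> then ch x else 0) \<in> Lip0"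
  using x0_in_Kxi by (auto simp: Lip0_def Lip_ball_def)

lemma Lip0_mix:
  "ch \<in> Lip0 \<Longrightarrow> ch' \<in> Lip0 \<Longrightarrow> 0 \<le> t \<Longrightarrow> t \<le> 1 \<Longrightarrow> (\<lambda>x. t * ch x + (1 - t) * ch' x) \<in> Lip0"
  by (auto simp: Lip0_def Lip_ball_mix)

lemma compact_Lip0: "compact Lip0"
proof -
  let ?P = "PiE UNIV (\<lambda>_. {- Kbound..Kbound}) :: (real^'n^'n \<Rightarrow> real) set"
  have "compactin (product_topology (\<lambda>_. euclidean) UNIV) ?P"
    unfolding compactin_PiE by simp
  then have P: "compact ?P" by (simp add: euclidean_product_topology)
  have coord: "continuous_on UNIV (\<lambda>ch :: real^'n^'n \<Rightarrow> real. ch x)" for x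
    by (rule continuous_on_product_coordinates)
  have "0 \<le> Kbound" using Lip_ball_bounded[OF Lip_ball_zero x0_in_Kxi] by simp
  then have "\<bar>ch x\<bar> \<le> Kbound" if "ch \<in> Lip0" for ch x
    using that Lip_ball_bounded[of ch x] by (cases "x \<in> Kxi \<xi>") (auto simp: Lip0_def)
  then have "Lip0 \<subseteq> ?P" by (auto simp: abs_le_iff) (metis minus_le_iff)
  have "Lip0 = {ch. \<bar>ch (x0 \<xi>)\<bar> \<le> 1} \<inter>
      ((\<Inter>x\<in>Kxi \<xi>. \<Inter>y\<in>Kxi \<xi>. {ch. \<bar>ch x - ch y\<bar> \<le> dist x y}) \<inter> (\<Inter>x\<in>- Kxi \<xi>. {ch. ch x = 0}))"
    by (auto simp: Lip0_def Lip_ball_def)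
  also have "closed \<dots>"
    using closed_Collect_le[OF continuous_on_rabs[OF continuous_on_diff[OF coord coord]] continuous_on_const]
      closed_Collect_le[OF continuous_on_rabs[OF coord] continuous_on_const]
      closed_Collect_eq[OF coord continuous_on_const]
    by (intro closed_Int closed_INT ballI) simp_all
  finally have "closed Lip0" .
  moreover have "?P \<inter> Lip0 = Lip0" using \<open>Lip0 \<subseteq> ?P\<close> by blast
  ultimately show ?thesis using compact_Int_closed[OF P] by metis
qed

text \<open>For 1-Lipschitz functions on a compact set pointwise convergence is uniform: closeness
  d/3 on a finite d/3-net propagates to closeness d on K. Continuity for the uniform norm on K
  therefore gives continuity for the product topology, in which the ball is compact.\<close>

lemma continuous_on_Lip0:
  assumes "\<And>e. 0 < e \<Longrightarrow> \<exists>d>0. \<forall>ch\<in>Lip_ball \<xi>. \<forall>ch'\<in>Lip_ball \<xi>.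
    (\<forall>x\<in>Kxi \<xi>. \<bar>ch x - ch' x\<bar> \<le> d) \<longrightarrow> \<bar>G ch - G ch'\<bar> \<le> (e::real)"
  shows "continuous_on Lip0 G"
  unfolding continuous_on_def tendsto_iff
proof (intro ballI allI impI)
  fix ch and e :: real assume ch: "ch \<in> Lip0" and "0 < e"
  then obtain d where d: "0 < d" and dG: "\<And>ch ch'. ch \<in> Lip_ball \<xi> \<Longrightarrow> ch' \<in> Lip_ball \<xi> \<Longrightarrow>
      (\<forall>x\<in>Kxi \<xi>. \<bar>ch x - ch' x\<bar> \<le> d) \<Longrightarrow> \<bar>G ch - G ch'\<bar> \<le> e / 2"
    using assms[of "e / 2"] by auto
  obtain T where T: "finite T" "T \<subseteq> Kxi \<xi>" "Kxi \<xi> \<subseteq> (\<Union>x\<in>T. ball x (d / 3))"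
    using compactE_image[OF compact_Kxi, of "Kxi \<xi>" "\<lambda>x. ball x (d / 3)"] d
    by (metis UN_I centre_in_ball divide_pos_pos open_ball subsetI zero_less_numeral)
  have "\<forall>\<^sub>F ch' in at ch within Lip0. \<forall>x\<in>T. dist (ch' x) (ch x) < d / 3"
  proof (rule eventually_ball_finite[OF T(1)], rule ballI)
    fix x
    have "((\<lambda>f :: real^'n^'n \<Rightarrow> real. f x) \<longlongrightarrow> ch x) (at ch within Lip0)"
      using continuous_on_product_coordinates[of x] ch
      by (metis UNIV_I continuous_on_def continuous_on_subset subset_UNIV)
    then show "\<forall>\<^sub>F ch' in at ch within Lip0. dist (ch' x) (ch x) < d / 3"
      by (rule tendstoD) (use d in simp)
  qed
  moreover have "\<forall>\<^sub>F ch' in at ch within Lip0. ch' \<in> Lip0"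
    by (simp add: eventually_at_filter)
  ultimately show "\<forall>\<^sub>F ch' in at ch within Lip0. dist (G ch') (G ch) < e"
  proof eventually_elim
    case (elim ch')
    have lip: "ch \<in> Lip_ball \<xi>" "ch' \<in> Lip_ball \<xi>" using ch elim by (auto simp: Lip0_def)
    have "\<bar>ch' x - ch x\<bar> \<le> d" if x: "x \<in> Kxi \<xi>" for x
    proof -
      obtain y where y: "y \<in> T" "dist y x < d / 3" using T(3) x by auto
      then have "\<bar>ch' y - ch y\<bar> < d / 3" using elim by (auto simp: dist_real_def)
      moreover have "\<bar>ch y - ch x\<bar> \<le> dist y x" "\<bar>ch' y - ch' x\<bar> \<le> dist y x"
        using lip x y T(2) by (auto simp: Lip_ball_def)
      ultimately show ?thesis using y by linarith
    qed
    then have "\<bar>G ch' - G ch\<bar> \<le> e / 2" by (intro dG lip ballI)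
    then show ?case using \<open>0 < e\<close> by (simp add: dist_real_def)
  qed
qed

lemma Lip_functionals_continuous: "F \<in> Lip_functionals \<Longrightarrow> continuous_on Lip0 F"
  by (rule continuous_on_Lip0) (rule Lip_functionals_modulus)

section \<open>Laws of increasing paths\<close>

lemma grad_path_measurable:
  assumes "admissible_path q"
  shows "(\<lambda>u. grad \<xi> (q u)) \<in> lebesgue_on {0..<1} \<rightarrow>\<^sub>M Kspace \<xi>"
proof (rule measurable_restrict_space2)
  show "(\<lambda>u. grad \<xi> (q u)) \<in> space (lebesgue_on {0..<1}) \<rightarrow> Kxi \<xi>"
    using assms by (auto simp: admissible_path_def Kxi_def)
  show "(\<lambda>u. grad \<xi> (q u)) \<in> borel_measurable (lebesgue_on {0..<1})"
    using admissible_measurable[OF assms] borel_measurable_continuous_onI[OF continuous_grad]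
    by (rule measurable_compose)
qed

lemma PupE:
  assumes "\<mu> \<in> Pup \<xi>"
  obtains q where "admissible_path q"
    "\<mu> = distr (lebesgue_on {0..<1}) (Kspace \<xi>) (\<lambda>u. grad \<xi> (q u))"
  using assms unfolding Pup_def by blast

lemma Pup_prob_space: "\<mu> \<in> Pup \<xi> \<Longrightarrow> prob_space \<mu>"
  by (elim PupE) (simp add: prob_space.prob_space_distr[OF prob_space_lebesgue_unit] grad_path_measurable)

lemma Pup_sets: "\<mu> \<in> Pup \<xi> \<Longrightarrow> sets \<mu> = sets (Kspace \<xi>)"
  by (elim PupE) simp

lemma Pup_space: "\<mu> \<in> Pup \<xi> \<Longrightarrow> space \<mu> = Kxi \<xi>"
  by (elim PupE) (simp add: space_restrict_space)

lemma Pup_finite_K: "\<mu> \<in> Pup \<xi> \<Longrightarrow> finite_K_measure \<xi> \<mu>"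
  using Pup_prob_space[of \<mu>] Pup_sets[of \<mu>] Pup_space[of \<mu>]
  by (simp add: finite_K_measure_def prob_space_def)

lemma Pup_measure_Kxi: "\<mu> \<in> Pup \<xi> \<Longrightarrow> measure \<mu> (Kxi \<xi>) = 1"
  using prob_space.prob_space[OF Pup_prob_space[of \<mu>]] Pup_space[of \<mu>] by simp

lemma emb_Pup: "\<mu> \<in> Pup \<xi> \<Longrightarrow> emb \<mu> \<in> Lip_functionals"
  using emb_in_M1 Pup_finite_K M1_subset_Lip_functionals by blast

lemma dP_upper:
  "\<mu> \<in> Pup \<xi> \<Longrightarrow> \<nu> \<in> Pup \<xi> \<Longrightarrow> ch \<in> Lip_ball \<xi> \<Longrightarrow> integral\<^sup>L \<mu> ch - integral\<^sup>L \<nu> ch \<le> dP \<xi> \<mu> \<nu>"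
  using dM_upper[OF emb_Pup emb_Pup, of \<mu> \<nu> ch] by (simp add: dP_def emb_def)

lemma dP_least:
  "(\<And>ch. ch \<in> Lip_ball \<xi> \<Longrightarrow> integral\<^sup>L \<mu> ch - integral\<^sup>L \<nu> ch \<le> D) \<Longrightarrow> dP \<xi> \<mu> \<nu> \<le> D"
  unfolding dP_def by (rule dM_least) (simp add: emb_def)

text \<open>The path that holds the value \<open>a k\<close> on an interval of length
  \<open>m k\<close> realises any weights along the chain. This supplies, chain by chain, the
  convexity that \<open>Pup\<close> as a whole may not have.\<close>

lemma chain_law:
  fixes a :: "nat \<Rightarrow> real^'n^'n" and m :: "nat \<Rightarrow> real"
  assumes a: "\<And>k. k \<le> M \<Longrightarrow> psd (a k) \<and> norm (a k) \<le> 1"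
    and incr: "\<And>k. k < M \<Longrightarrow> psd (a (Suc k) - a k)"
    and m: "\<And>k. 0 \<le> m k" "(\<Sum>k<Suc M. m k) = 1"
  shows "\<exists>\<nu>\<in>Pup \<xi>. \<forall>f\<in>borel_measurable (Kspace \<xi>).
    integral\<^sup>L \<nu> f = (\<Sum>k<Suc M. m k * f (grad \<xi> (a k)) :: real)"
proof -
  \<comment> \<open>Nonnegativity of \<open>m k\<close> is available for every k, also beyond M,
    which makes these partial sums monotone on all indices.\<close>
  define c where "c k = (\<Sum>i<k. m i)" for k
  have c: "c 0 = 0" "c (Suc M) = 1" "mono c"
    using m by (auto simp: c_def intro!: monoI sum_mono2)
  obtain q where q: "admissible_path q"
    "\<And>k u. k \<le> M \<Longrightarrow> c k \<le> u \<Longrightarrow> u < c (Suc k) \<Longrightarrow> q u = a k"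
    by (rule admissible_step_path[of M a c]) (use a incr c in auto)
  define \<nu> where "\<nu> = distr (lebesgue_on {0..<1}) (Kspace \<xi>) (\<lambda>u. grad \<xi> (q u))"
  have "\<nu> \<in> Pup \<xi>" using q(1) by (auto simp: Pup_def \<nu>_def)
  moreover have "integral\<^sup>L \<nu> f = (\<Sum>k<Suc M. m k * f (grad \<xi> (a k)) :: real)"
    if f: "f \<in> borel_measurable (Kspace \<xi>)" for f
  proof -
    have "integral\<^sup>L \<nu> f = (LINT u|lebesgue_on {0..<1}. f (grad \<xi> (q u)))"
      unfolding \<nu>_def by (rule integral_distr[OF grad_path_measurable[OF q(1)] f])
    also have "\<dots> = (\<Sum>k<Suc M. (c (Suc k) - c k) * f (grad \<xi> (a k)))"
      using q(2) by (intro integral_step_function[OF c]) (simp add: less_Suc_eq_le)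
    finally show ?thesis by (simp add: c_def)
  qed
  ultimately show ?thesis by blast
qed

lemma Pup_nonempty: "Pup \<xi> \<noteq> {}"
  using chain_law[of 0 "\<lambda>_. 0" "\<lambda>_. 1"] by auto

text \<open>One n serves all \<open>ch\<close> at once: for a 1-Lipschitz \<open>ch\<close> the
  error is at most the mean distance between the gradients along the path and along its sampled
  version, and this mean tends to 0 by dominated convergence.\<close>

lemma Pup_discretize:
  assumes "\<mu> \<in> Pup \<xi>" "0 < e"
  obtains M and a :: "nat \<Rightarrow> real^'n^'n"
  where "\<And>k. k \<le> M \<Longrightarrow> psd (a k) \<and> norm (a k) \<le> 1"
    and "\<And>k. k < M \<Longrightarrow> psd (a (Suc k) - a k)"
    and "\<And>ch. ch \<in> Lip_ball \<xi> \<Longrightarrow>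
      \<bar>integral\<^sup>L \<mu> ch - (\<Sum>k<Suc M. 1 / real (Suc M) * ch (grad \<xi> (a k)))\<bar> \<le> e"
proof -
  interpret L: prob_space "lebesgue_on {0..<1::real}" by (rule prob_space_lebesgue_unit)
  obtain q where q: "admissible_path q"
    and \<mu>: "\<mu> = distr (lebesgue_on {0..<1}) (Kspace \<xi>) (\<lambda>u. grad \<xi> (q u))"
    using assms(1) by (rule PupE)
  have qK: "psd (q u) \<and> norm (q u) \<le> 1" if "0 \<le> u" "u < 1" for u
    using q that by (simp add: admissible_path_def)
  have gK: "grad \<xi> (q u) \<in> Kxi \<xi>" if "0 \<le> u" "u < 1" for u
    using qK[OF that] by (auto simp: Kxi_def)
  let ?D = "\<lambda>n u. norm (grad \<xi> (q (grid n u)) - grad \<xi> (q u))"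
  have grad_meas: "grad \<xi> \<in> borel_measurable borel"
    by (rule borel_measurable_continuous_onI[OF continuous_grad])
  have meas [measurable]: "(\<lambda>u. grad \<xi> (q u)) \<in> borel_measurable (lebesgue_on {0..<1})"
    "(\<lambda>u. grad \<xi> (q (grid n u))) \<in> borel_measurable (lebesgue_on {0..<1})" for n
    using measurable_compose[OF admissible_measurable[OF q] grad_meas]
      borel_measurable_lebesgue_on[OF measurable_compose_grid] by auto
  have D_bound: "?D n u \<le> Kbound" if "u \<in> {0..<1}" for n u
    using dist_le_Kbound[OF gK gK, of "grid n u" u] grid_bounds[of u n] that by (simp add: dist_norm)
  have "(\<lambda>n. LINT u|lebesgue_on {0..<1}. ?D n u) \<longlonglongrightarrow> (LINT u|lebesgue_on {0..<1::real}. 0)"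
  proof (rule integral_dominated_convergence[where w = "\<lambda>_. Kbound"])
    show "AE u in lebesgue_on {0..<1}. (\<lambda>n. ?D n u) \<longlonglongrightarrow> 0"
    proof (rule AE_I2)
      fix u :: real assume "u \<in> space (lebesgue_on {0..<1})"
      then have "(\<lambda>n. q (grid n u)) \<longlonglongrightarrow> q u" by (intro admissible_grid_tendsto[OF q]) auto
      then have "(\<lambda>n. grad \<xi> (q (grid n u))) \<longlonglongrightarrow> grad \<xi> (q u)"
        using continuous_on_tendsto_compose[OF continuous_grad[of UNIV]] by simp
      then show "(\<lambda>n. ?D n u) \<longlonglongrightarrow> 0"
        using LIM_zero_iff tendsto_norm_zero by blast
    qed
  qed (use D_bound in \<open>auto intro!: AE_I2\<close>)
  then have "\<forall>\<^sub>F n in sequentially. (LINT u|lebesgue_on {0..<1}. ?D n u) < e"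
    using assms(2) by (intro order_tendstoD(2)) auto
  then obtain n where n: "(LINT u|lebesgue_on {0..<1}. ?D n u) < e"
    by (auto simp: eventually_sequentially)
  \<comment> \<open>The value of \<open>grid n\<close> on the k-th of n + 1 equal intervals; the cap
    keeps the last sample point below 1, where q is admissible.\<close>
  define p where "p k = min ((real k + 1) / real (Suc n)) (1 - 1 / real (Suc n))" for k :: nat
  have p: "0 \<le> p k" "p k < 1" for k by (auto simp: p_def min_less_iff_disj divide_simps)
  have p_mono: "p k \<le> p (Suc k)" for k
    unfolding p_def by (intro min.mono divide_right_mono) auto
  show thesis
  proof (rule that[of n "\<lambda>k. q (p k)"])
    show "psd (q (p k)) \<and> norm (q (p k)) \<le> 1" for k using qK p by blast
    show "psd (q (p (Suc k)) - q (p k))" for k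
      using q p p_mono by (simp add: admissible_path_def)
    fix ch assume ch: "ch \<in> Lip_ball \<xi>"
    define c where "c k = min 1 (real k / real (Suc n))" for k :: nat
    have c: "c 0 = 0" "c (Suc n) = 1" "mono c"
      unfolding mono_def c_def by (auto intro!: min.mono divide_right_mono simp del: min.bounded_iff)
    have c_diff: "c (Suc k) - c k = 1 / real (Suc n)" if "k < Suc n" for k
      using that by (simp add: c_def divide_simps)
    have step: "(LINT u|lebesgue_on {0..<1}. ch (grad \<xi> (q (grid n u))))
        = (\<Sum>k<Suc n. (c (Suc k) - c k) * ch (grad \<xi> (q (p k))))"
    proof (rule integral_step_function[OF c])
      fix k u assume k: "k < Suc n" "c k \<le> u" "u < c (Suc k)"
      then have "real k / real (Suc n) \<le> u" "u < real (Suc k) / real (Suc n)"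
        by (auto simp: c_def)
      then have "\<lfloor>real (Suc n) * u\<rfloor> = int k"
        by (intro floor_unique) (simp_all add: field_simps)
      then have "grid n u = p k" by (simp add: grid_def p_def)
      then show "ch (grad \<xi> (q (grid n u))) = ch (grad \<xi> (q (p k)))" by simp
    qed
    have lip: "\<bar>ch (grad \<xi> (q u)) - ch (grad \<xi> (q (grid n u)))\<bar> \<le> ?D n u" if "u \<in> {0..<1}" for u
      using ch gK[of u] gK[of "grid n u"] grid_bounds[of u n] that
      by (auto simp: Lip_ball_def dist_norm norm_minus_commute)
    have ch_int: "integrable (lebesgue_on {0..<1}) (\<lambda>u. ch (grad \<xi> (q u)))"
      "integrable (lebesgue_on {0..<1}) (\<lambda>u. ch (grad \<xi> (q (grid n u))))"
    proof -
      have "(\<lambda>u. grad \<xi> (q (grid n u))) \<in> lebesgue_on {0..<1} \<rightarrow>\<^sub>M Kspace \<xi>"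
        using meas(2) gK grid_bounds by (intro measurable_restrict_space2) auto
      from measurable_compose[OF this Lip_ball_measurable[OF ch]]
      show "integrable (lebesgue_on {0..<1}) (\<lambda>u. ch (grad \<xi> (q (grid n u))))"
        using Lip_ball_bounded[OF ch gK] grid_bounds
        by (intro L.integrable_const_bound[of _ Kbound]) (auto intro!: AE_I2)
      from measurable_compose[OF grad_path_measurable[OF q] Lip_ball_measurable[OF ch]]
      show "integrable (lebesgue_on {0..<1}) (\<lambda>u. ch (grad \<xi> (q u)))"
        using Lip_ball_bounded[OF ch gK]
        by (intro L.integrable_const_bound[of _ Kbound]) (auto intro!: AE_I2)
    qed
    have "integral\<^sup>L \<mu> ch = (LINT u|lebesgue_on {0..<1}. ch (grad \<xi> (q u)))"
      unfolding \<mu> by (rule integral_distr[OF grad_path_measurable[OF q] Lip_ball_measurable[OF ch]])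
    moreover have "(\<Sum>k<Suc n. 1 / real (Suc n) * ch (grad \<xi> (q (p k))))
        = (LINT u|lebesgue_on {0..<1}. ch (grad \<xi> (q (grid n u))))"
      unfolding step by (intro sum.cong) (auto simp: c_diff simp del: of_nat_Suc)
    ultimately have "\<bar>integral\<^sup>L \<mu> ch - (\<Sum>k<Suc n. 1 / real (Suc n) * ch (grad \<xi> (q (p k))))\<bar>
        = \<bar>LINT u|lebesgue_on {0..<1}. ch (grad \<xi> (q u)) - ch (grad \<xi> (q (grid n u)))\<bar>"
      using ch_int by simp
    also have "\<dots> \<le> (LINT u|lebesgue_on {0..<1}. \<bar>ch (grad \<xi> (q u)) - ch (grad \<xi> (q (grid n u)))\<bar>)"
      by (rule integral_abs_bound)
    also have "\<dots> \<le> (LINT u|lebesgue_on {0..<1}. ?D n u)"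
    proof (rule integral_mono)
      show "integrable (lebesgue_on {0..<1}) (?D n)"
        using D_bound by (intro L.integrable_const_bound[of _ Kbound]) (auto intro!: AE_I2)
    qed (use ch_int lip in auto)
    finally show "\<bar>integral\<^sup>L \<mu> ch - (\<Sum>k<Suc n. 1 / real (Suc n) * ch (grad \<xi> (q (p k))))\<bar> \<le> e"
      using n by simp
  qed
qed

section \<open>Barycentres\<close>

lemma space_Pup_borel: "space (Pup_borel \<xi>) = Pup \<xi>"
  and sets_Pup_borel: "sets (Pup_borel \<xi>) = sigma_sets (Pup \<xi>) (Pup_open \<xi>)"
  unfolding Pup_borel_def by (auto simp: Pup_open_def intro!: space_measure_of sets_measure_of)

section \<open>Measurability on the space of laws\<close>

lemma Pup_lipschitz_measurable:
  fixes f :: "(real^'n^'n) measure \<Rightarrow> real"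
  assumes "0 \<le> C" and lip: "\<And>\<mu> \<nu>. \<mu> \<in> Pup \<xi> \<Longrightarrow> \<nu> \<in> Pup \<xi> \<Longrightarrow> \<bar>f \<mu> - f \<nu>\<bar> \<le> C * dP \<xi> \<mu> \<nu>"
  shows "f \<in> borel_measurable (Pup_borel \<xi>)"
proof (rule borel_measurableI)
  fix S :: "real set" assume "open S"
  have "f -` S \<inter> Pup \<xi> \<in> Pup_open \<xi>"
    unfolding Pup_open_def
  proof (intro CollectI conjI ballI)
    fix \<mu> assume \<mu>: "\<mu> \<in> f -` S \<inter> Pup \<xi>"
    then obtain e where e: "0 < e" "\<And>y. dist y (f \<mu>) < e \<Longrightarrow> y \<in> S"
      using \<open>open S\<close> unfolding open_dist by auto
    have "\<nu> \<in> f -` S \<inter> Pup \<xi>" if \<nu>: "\<nu> \<in> Pup \<xi>" "dP \<xi> \<mu> \<nu> < e / (C + 1)" for \<nu>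
    proof -
      have "C * dP \<xi> \<mu> \<nu> \<le> C * (e / (C + 1))" using \<nu> \<open>0 \<le> C\<close> by (intro mult_left_mono) auto
      also have "\<dots> < e" using \<open>0 \<le> C\<close> e by (simp add: field_simps)
      finally show ?thesis using lip[of \<mu> \<nu>] \<mu> \<nu> e(2)[of "f \<nu>"] by (auto simp: dist_real_def)
    qed
    then show "\<exists>e>0. \<forall>\<nu>\<in>Pup \<xi>. dP \<xi> \<mu> \<nu> < e \<longrightarrow> \<nu> \<in> f -` S \<inter> Pup \<xi>"
      using \<open>0 \<le> C\<close> e by (intro exI[of _ "e / (C + 1)"]) auto
  qed auto
  then show "f -` S \<inter> space (Pup_borel \<xi>) \<in> sets (Pup_borel \<xi>)"
    by (simp add: space_Pup_borel sets_Pup_borel sigma_sets.Basic)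
qed

text \<open>Dividing by C and subtracting the value at \<open>x0\<close> lands in the ball; between
  two probability measures the constant cancels.\<close>

lemma Pup_integral_lipschitz:
  assumes "0 < C" and lip: "\<And>x y. x \<in> Kxi \<xi> \<Longrightarrow> y \<in> Kxi \<xi> \<Longrightarrow> \<bar>h x - h y :: real\<bar> \<le> C * dist x y"
    and \<mu>: "\<mu> \<in> Pup \<xi>" and \<nu>: "\<nu> \<in> Pup \<xi>"
  shows "integral\<^sup>L \<mu> h - integral\<^sup>L \<nu> h \<le> C * dP \<xi> \<mu> \<nu>"
proof -
  define g where "g x = h x / C - h (x0 \<xi>) / C" for x
  have "\<bar>h x / C - h y / C\<bar> \<le> dist x y" if "x \<in> Kxi \<xi>" "y \<in> Kxi \<xi>" for x y
    using lip[OF that] \<open>0 < C\<close>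
    by (simp add: diff_divide_distrib[symmetric] abs_divide pos_divide_le_eq mult.commute)
  then have g: "g \<in> Lip_ball \<xi>"
    using Lip_ball_shift[of "\<lambda>x. h x / C"] by (simp add: g_def[abs_def])
  have h: "h x = C * g x + h (x0 \<xi>)" for x using \<open>0 < C\<close> by (simp add: g_def field_simps)
  have "integral\<^sup>L \<rho> h = C * integral\<^sup>L \<rho> g + h (x0 \<xi>)" if \<rho>: "\<rho> \<in> Pup \<xi>" for \<rho>
  proof -
    interpret prob_space \<rho> using Pup_prob_space[OF \<rho>] .
    have "integral\<^sup>L \<rho> h = (\<integral>x. C * g x + h (x0 \<xi>) \<partial>\<rho>)" by (simp only: h[symmetric])
    also have "\<dots> = C * integral\<^sup>L \<rho> g + h (x0 \<xi>)"
      using Lip_ball_integrable[OF Pup_finite_K[OF \<rho>] g] by (simp add: prob_space)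
    finally show ?thesis .
  qed
  then have "integral\<^sup>L \<mu> h - integral\<^sup>L \<nu> h = C * (integral\<^sup>L \<mu> g - integral\<^sup>L \<nu> g)"
    using \<mu> \<nu> by (simp add: algebra_simps)
  also have "\<dots> \<le> C * dP \<xi> \<mu> \<nu>"
    using dP_upper[OF \<mu> \<nu> g] \<open>0 < C\<close> by simp
  finally show ?thesis .
qed

lemma dP_commute: "\<mu> \<in> Pup \<xi> \<Longrightarrow> \<nu> \<in> Pup \<xi> \<Longrightarrow> dP \<xi> \<mu> \<nu> = dP \<xi> \<nu> \<mu>"
  by (simp add: dP_def dM_commute emb_Pup)

lemma Pup_integral_measurable:
  assumes "0 < C" and "\<And>x y. x \<in> Kxi \<xi> \<Longrightarrow> y \<in> Kxi \<xi> \<Longrightarrow> \<bar>h x - h y :: real\<bar> \<le> C * dist x y"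
  shows "(\<lambda>\<mu>. integral\<^sup>L \<mu> h) \<in> borel_measurable (Pup_borel \<xi>)"
proof (rule Pup_lipschitz_measurable)
  show "\<bar>integral\<^sup>L \<mu> h - integral\<^sup>L \<nu> h\<bar> \<le> C * dP \<xi> \<mu> \<nu>" if "\<mu> \<in> Pup \<xi>" "\<nu> \<in> Pup \<xi>" for \<mu> \<nu>
    using Pup_integral_lipschitz[OF assms that] Pup_integral_lipschitz[OF assms that(2,1)]
      dP_commute[OF that] by simp
qed (use assms in simp)

text \<open>The sets of \<open>Pup_borel\<close> come from the distance, for which integrals of
  Lipschitz functions are continuous. The indicator of a closed set is a pointwise limit of such
  functions, and dominated convergence carries measurability over to the limit.\<close>

lemma Pup_closed_measurable:
  assumes "closed A" "A \<subseteq> Kxi \<xi>"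
  shows "(\<lambda>\<nu>. emeasure \<nu> A) \<in> borel_measurable (Pup_borel \<xi>)"
proof (cases "A = {}")
  case False
  have A: "A \<in> sets (Kspace \<xi>)"
    using assms by (auto simp: sets_restrict_space image_iff intro!: bexI[of _ A])
  \<comment> \<open>This falls from 1 on A to 0 at distance 1/(n + 1). For empty A it would be
    constantly 1, because \<open>infdist\<close> to the empty set is 0 by convention; hence the case
    split.\<close>
  define h where "h n x = max 0 (1 - (real n + 1) * infdist x A)" for n x
  have lip: "\<bar>h n x - h n y\<bar> \<le> (real n + 1) * dist x y" for n x y
  proof -
    have "\<bar>(real n + 1) * infdist x A - (real n + 1) * infdist y A\<bar> \<le> (real n + 1) * dist x y"
      using infdist_triangle_abs[of x A y]
      by (simp add: right_diff_distrib[symmetric] abs_mult)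
    then show ?thesis unfolding h_def by linarith
  qed
  have h_bound: "\<bar>h n x\<bar> \<le> 1" for n x by (auto simp: h_def infdist_nonneg)
  have h_meas: "h n \<in> borel_measurable (Kspace \<xi>)" for n
    using lip by (rule Lip_measurable)
  have h_lim: "(\<lambda>n. h n x) \<longlonglongrightarrow> indicator A x" for x
  proof (cases "x \<in> A")
    case True
    then show ?thesis by (simp add: h_def)
  next
    case False
    then have "infdist x A > 0"
      using in_closed_iff_infdist_zero[OF \<open>closed A\<close> \<open>A \<noteq> {}\<close>] infdist_nonneg[of x A]
      by (simp add: less_le)
    then obtain N where N: "1 < real N * infdist x A"
      using ex_less_of_nat_mult by blast
    have "h n x = 0" if "N \<le> n" for n
    proof -
      have "real N * infdist x A \<le> (real n + 1) * infdist x A"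
        using that \<open>infdist x A > 0\<close> by (intro mult_right_mono) auto
      then show ?thesis using N by (simp add: h_def)
    qed
    then have "\<forall>\<^sub>F n in sequentially. h n x = 0" by (auto simp: eventually_sequentially)
    then show ?thesis using False by (simp add: tendsto_eventually)
  qed
  have "(\<lambda>\<nu>. measure \<nu> A) \<in> borel_measurable (Pup_borel \<xi>)"
  proof (rule borel_measurable_LIMSEQ_metric)
    show "(\<lambda>\<nu>. integral\<^sup>L \<nu> (h n)) \<in> borel_measurable (Pup_borel \<xi>)" for n
      using lip by (intro Pup_integral_measurable[of "real n + 1"]) auto
    fix \<nu> assume "\<nu> \<in> space (Pup_borel \<xi>)"
    then have \<nu>: "\<nu> \<in> Pup \<xi>" by (simp add: space_Pup_borel)
    interpret prob_space \<nu> using Pup_prob_space[OF \<nu>] .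
    have "(\<lambda>n. integral\<^sup>L \<nu> (h n)) \<longlonglongrightarrow> integral\<^sup>L \<nu> (indicator A)"
      using A h_meas h_lim h_bound Pup_sets[OF \<nu>]
      by (intro integral_dominated_convergence[where w = "\<lambda>_. 1"])
        (auto intro!: AE_I2 cong: measurable_cong_sets)
    then show "(\<lambda>n. integral\<^sup>L \<nu> (h n)) \<longlonglongrightarrow> measure \<nu> A"
      using A Pup_sets[OF \<nu>] by (simp add: Int_absorb2 sets.sets_into_space)
  qed
  then have "(\<lambda>\<nu>. ennreal (measure \<nu> A)) \<in> borel_measurable (Pup_borel \<xi>)" by measurable
  moreover have "ennreal (measure \<nu> A) = emeasure \<nu> A" if "\<nu> \<in> space (Pup_borel \<xi>)" for \<nu>
    using that Pup_prob_space[of \<nu>]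
    by (simp add: space_Pup_borel finite_measure.emeasure_eq_measure prob_space_def)
  ultimately show ?thesis by (simp cong: measurable_cong)
qed simp

text \<open>Closed subsets of K form an intersection-stable generator of its Borel sets, so
  measurable evaluations on them suffice. The inclusion into \<open>subprob_algebra\<close> makes
  \<open>join\<close> applicable to \<eta>.\<close>

lemma Pup_borel_id_measurable: "(\<lambda>\<nu>. \<nu>) \<in> Pup_borel \<xi> \<rightarrow>\<^sub>M subprob_algebra (Kspace \<xi>)"
proof (rule measurable_subprob_algebra_generated)
  let ?G = "(\<inter>) (Kxi \<xi>) ` Collect closed"
  have closed_K: "closed (Kxi \<xi>)" using compact_Kxi compact_imp_closed by blast
  have borel: "sets borel = sigma_sets UNIV (Collect closed)"
    unfolding borel_eq_closed by (rule sets_measure_of) simp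
  show "sets (Kspace \<xi>) = sigma_sets (Kxi \<xi>) ?G"
    unfolding sets_restrict_space borel using closed_K by (intro sigma_sets_Int) auto
  show "Int_stable ?G"
  proof (rule Int_stableI)
    fix a b assume "a \<in> ?G" "b \<in> ?G"
    then obtain A B where "closed A" "closed B" "a = Kxi \<xi> \<inter> A" "b = Kxi \<xi> \<inter> B" by auto
    then show "a \<inter> b \<in> ?G" by (intro image_eqI[of _ _ "A \<inter> B"]) auto
  qed
  show "?G \<subseteq> Pow (Kxi \<xi>)" by auto
  show "subprob_space \<nu>" "sets \<nu> = sets (Kspace \<xi>)" if "\<nu> \<in> space (Pup_borel \<xi>)" for \<nu>
    using that Pup_prob_space Pup_sets by (auto simp: space_Pup_borel intro: prob_space_imp_subprob_space)
  show "(\<lambda>\<nu>. emeasure \<nu> A) \<in> borel_measurable (Pup_borel \<xi>)" if "A \<in> ?G" for A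
    using that closed_K by (intro Pup_closed_measurable) auto
  show "(\<lambda>\<nu>. emeasure \<nu> (Kxi \<xi>)) \<in> borel_measurable (Pup_borel \<xi>)"
    using closed_K by (intro Pup_closed_measurable) auto
qed

section \<open>The barycentre as a measure\<close>

lemma PP_measurable_iff: "\<eta> \<in> PP \<xi> \<Longrightarrow> f \<in> \<eta> \<rightarrow>\<^sub>M N \<longleftrightarrow> f \<in> Pup_borel \<xi> \<rightarrow>\<^sub>M N"
  by (intro arg_cong2[where f = "(\<in>)"] measurable_cong_sets) (auto simp: PP_def)

text \<open>Taking the barycentre is the multiplication of the Giry monad. The identity also
  confirms that the set function in \<open>Bar\<close> is a measure; for any other set function
  \<open>measure_of\<close> would silently return zero values.\<close>

lemma Bar_eq_join:
  assumes "\<eta> \<in> PP \<xi>"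
  shows "Bar \<xi> \<eta> = join (distr \<eta> (subprob_algebra (Kspace \<xi>)) (\<lambda>\<nu>. \<nu>))" (is "_ = ?J")
proof -
  have id: "(\<lambda>\<nu>. \<nu>) \<in> \<eta> \<rightarrow>\<^sub>M subprob_algebra (Kspace \<xi>)"
    using Pup_borel_id_measurable PP_measurable_iff[OF assms] by blast
  have sets: "sets ?J = sets (Kspace \<xi>)" by simp
  have space: "space ?J = Kxi \<xi>" using sets_eq_imp_space_eq[OF sets] by (simp add: space_restrict_space)
  have em: "emeasure ?J A = (\<integral>\<^sup>+ \<nu>. emeasure \<nu> A \<partial>\<eta>)" if "A \<in> sets (Kspace \<xi>)" for A
    using that id by (simp add: emeasure_join nn_integral_distr measurable_emeasure_subprob_algebra)
  have "?J = measure_of (space ?J) (sets ?J) (emeasure ?J)" by (rule measure_of_of_measure[symmetric])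
  also have "\<dots> = Bar \<xi> \<eta>"
    unfolding Bar_def sets space
  proof (rule measure_of_eq)
    show "sets (Kspace \<xi>) \<subseteq> Pow (Kxi \<xi>)"
      using sets.space_closed[of "Kspace \<xi>"] by (simp add: space_restrict_space)
    show "emeasure ?J A = (\<integral>\<^sup>+ \<nu>. emeasure \<nu> A \<partial>\<eta>)" if "A \<in> sigma_sets (Kxi \<xi>) (sets (Kspace \<xi>))" for A
      using that em sets.sigma_sets_eq[of "Kspace \<xi>"] by (simp add: space_restrict_space)
  qed
  finally show ?thesis by simp
qed

lemma integral_Bar:
  assumes \<eta>: "\<eta> \<in> PP \<xi>" and f: "f \<in> borel_measurable (Kspace \<xi>)"
    and B: "\<And>x. x \<in> Kxi \<xi> \<Longrightarrow> \<bar>f x\<bar> \<le> (B::real)"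
  shows "integral\<^sup>L (Bar \<xi> \<eta>) f = (\<integral>\<nu>. integral\<^sup>L \<nu> f \<partial>\<eta>)"
proof -
  interpret prob_space \<eta> using \<eta> by (simp add: PP_def)
  have id: "(\<lambda>\<nu>. \<nu>) \<in> \<eta> \<rightarrow>\<^sub>M subprob_algebra (Kspace \<xi>)"
    using Pup_borel_id_measurable PP_measurable_iff[OF \<eta>] by blast
  interpret D: prob_space "distr \<eta> (subprob_algebra (Kspace \<xi>)) (\<lambda>\<nu>. \<nu>)"
    using id by (rule prob_space_distr)
  have "integral\<^sup>L (Bar \<xi> \<eta>) f = (\<integral>\<nu>. integral\<^sup>L \<nu> f \<partial>distr \<eta> (subprob_algebra (Kspace \<xi>)) (\<lambda>\<nu>. \<nu>))"
    unfolding Bar_eq_join[OF \<eta>]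
  proof (rule integral_join[OF f])
    show "\<bar>f x\<bar> \<le> B" if "x \<in> space (Kspace \<xi>)" for x using that B by (simp add: space_restrict_space)
    show "AE \<nu> in distr \<eta> (subprob_algebra (Kspace \<xi>)) (\<lambda>\<nu>. \<nu>). emeasure \<nu> (space \<nu>) \<le> ennreal 1"
      by (rule AE_I2) (auto simp: space_subprob_algebra subprob_space.emeasure_space_le_1)
  qed (auto intro: D.finite_measure_axioms)
  also have "\<dots> = (\<integral>\<nu>. integral\<^sup>L \<nu> f \<partial>\<eta>)"
    using id f B
    by (intro integral_distr integral_measurable_subprob_algebra[OF f])
  finally show ?thesis .
qed

lemma Bar_finite_K:
  assumes \<eta>: "\<eta> \<in> PP \<xi>"
  shows "finite_K_measure \<xi> (Bar \<xi> \<eta>)"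
proof -
  interpret prob_space \<eta> using \<eta> by (simp add: PP_def)
  have id: "(\<lambda>\<nu>. \<nu>) \<in> \<eta> \<rightarrow>\<^sub>M subprob_algebra (Kspace \<xi>)"
    using Pup_borel_id_measurable PP_measurable_iff[OF \<eta>] by blast
  have sets: "sets (Bar \<xi> \<eta>) = sets (Kspace \<xi>)" by (simp add: Bar_eq_join[OF \<eta>])
  have sp: "space (Bar \<xi> \<eta>) = Kxi \<xi>" using sets_eq_imp_space_eq[OF sets] by (simp add: space_restrict_space)
  have K: "Kxi \<xi> \<in> sets (Kspace \<xi>)"
    using sets.top[of "Kspace \<xi>"] by (simp add: space_restrict_space)
  have "emeasure (Bar \<xi> \<eta>) (Kxi \<xi>) = (\<integral>\<^sup>+ \<nu>. emeasure \<nu> (Kxi \<xi>) \<partial>\<eta>)"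
    using K id unfolding Bar_eq_join[OF \<eta>]
    by (simp add: emeasure_join nn_integral_distr measurable_emeasure_subprob_algebra)
  also have "\<dots> = (\<integral>\<^sup>+ \<nu>. 1 \<partial>\<eta>)"
  proof (rule nn_integral_cong)
    fix \<nu> assume "\<nu> \<in> space \<eta>"
    then have "\<nu> \<in> Pup \<xi>" using \<eta> by (simp add: PP_def)
    then show "emeasure \<nu> (Kxi \<xi>) = 1"
      using prob_space.emeasure_space_1[OF Pup_prob_space] Pup_space by metis
  qed
  finally have "emeasure (Bar \<xi> \<eta>) (space (Bar \<xi> \<eta>)) = 1" by (simp add: sp emeasure_space_1)
  then show ?thesis
    using sets sp by (auto simp: finite_K_measure_def intro!: finite_measureI)
qed

lemma emb_Bar: "\<eta> \<in> PP \<xi> \<Longrightarrow> emb (Bar \<xi> \<eta>) \<in> Lip_functionals"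
  using emb_in_M1[OF Bar_finite_K] M1_subset_Lip_functionals by blast

lemma emb_Bar_apply:
  "\<eta> \<in> PP \<xi> \<Longrightarrow> ch \<in> Lip_ball \<xi> \<Longrightarrow> emb (Bar \<xi> \<eta>) ch = (\<integral>\<nu>. integral\<^sup>L \<nu> ch \<partial>\<eta>)"
  unfolding emb_def by (rule integral_Bar[OF _ Lip_ball_measurable Lip_ball_bounded])

text \<open>Turns the finite weights delivered by \<open>minimax_weights\<close> into a competitor
  for the supremum in \<open>phi_bar\<close>.\<close>

lemma discrete_PP:
  assumes T: "finite T" "T \<subseteq> Pup \<xi>" and w: "\<And>\<nu>. \<nu> \<in> T \<Longrightarrow> 0 \<le> w \<nu>" "sum w T = 1"
  shows "\<exists>\<eta>\<in>PP \<xi>. \<forall>f\<in>borel_measurable (Pup_borel \<xi>).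
    integral\<^sup>L \<eta> f = (\<Sum>\<nu>\<in>T. w \<nu> * f \<nu> :: real)"
proof -
  have id: "(\<lambda>\<nu>. \<nu>) \<in> point_measure T (\<lambda>\<nu>. ennreal (w \<nu>)) \<rightarrow>\<^sub>M Pup_borel \<xi>"
    using T by (auto simp: measurable_def space_point_measure sets_point_measure space_Pup_borel)
  define \<eta> where "\<eta> = distr (point_measure T (\<lambda>\<nu>. ennreal (w \<nu>))) (Pup_borel \<xi>) (\<lambda>\<nu>. \<nu>)"
  have "prob_space (point_measure T (\<lambda>\<nu>. ennreal (w \<nu>)))"
    using T w by (intro prob_spaceI)
      (simp add: space_point_measure emeasure_point_measure_finite sum_ennreal)
  then have "prob_space \<eta>" unfolding \<eta>_def using id by (rule prob_space.prob_space_distr)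
  then have "\<eta> \<in> PP \<xi>" by (simp add: PP_def \<eta>_def space_Pup_borel)
  moreover have "integral\<^sup>L \<eta> f = (\<Sum>\<nu>\<in>T. w \<nu> * f \<nu> :: real)"
    if "f \<in> borel_measurable (Pup_borel \<xi>)" for f
    using T w by (simp add: \<eta>_def integral_distr[OF id that] lebesgue_integral_point_measure_finite)
  ultimately show ?thesis by blast
qed

end

section \<open>Duality\<close>

locale lipschitz_functional = smooth_potential \<xi> for \<xi> :: "real^'n::finite^'n \<Rightarrow> real" +
  fixes \<phi> :: "(real^'n^'n) measure \<Rightarrow> real"
  assumes lip: "\<And>\<mu> \<nu>. \<mu> \<in> Pup \<xi> \<Longrightarrow> \<nu> \<in> Pup \<xi> \<Longrightarrow> \<bar>\<phi> \<mu> - \<phi> \<nu>\<bar> \<le> dP \<xi> \<mu> \<nu>"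
begin

lemma phi_measurable: "\<phi> \<in> borel_measurable (Pup_borel \<xi>)"
  using lip by (intro Pup_lipschitz_measurable[of 1]) auto

lemma Pup_integral_bounded: "\<nu> \<in> Pup \<xi> \<Longrightarrow> ch \<in> Lip_ball \<xi> \<Longrightarrow> \<bar>integral\<^sup>L \<nu> ch\<bar> \<le> Kbound"
  using finite_K_integral_close[OF Pup_finite_K Lip_ball_integrable[OF Pup_finite_K], of \<nu> ch "\<lambda>_. 0" Kbound]
    Lip_ball_bounded[of ch] by (simp add: Pup_measure_Kxi)

text \<open>Two laws are at distance at most twice \<open>Kbound\<close>, so a Lipschitz functional
  is bounded. This makes it integrable against every \<eta> and makes the infimum in
  \<open>phi_star\<close> a genuine one.\<close>

lemma phi_bounded: "\<exists>B. \<forall>\<nu>\<in>Pup \<xi>. \<bar>\<phi> \<nu>\<bar> \<le> B"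
proof -
  obtain \<mu> where \<mu>: "\<mu> \<in> Pup \<xi>" using Pup_nonempty by blast
  have "\<bar>\<phi> \<nu>\<bar> \<le> \<bar>\<phi> \<mu>\<bar> + 2 * Kbound" if \<nu>: "\<nu> \<in> Pup \<xi>" for \<nu>
  proof -
    have "dP \<xi> \<nu> \<mu> \<le> 2 * Kbound"
    proof (rule dP_least)
      fix ch assume "ch \<in> Lip_ball \<xi>"
      then show "integral\<^sup>L \<nu> ch - integral\<^sup>L \<mu> ch \<le> 2 * Kbound"
        using Pup_integral_bounded[OF \<mu>, of ch] Pup_integral_bounded[OF \<nu>, of ch] by linarith
    qed
    then show ?thesis using lip[OF \<nu> \<mu>] by linarith
  qed
  then show ?thesis by blast
qed

lemma phi_star_lower:
  assumes ch: "ch \<in> Lip_ball \<xi>" and \<mu>: "\<mu> \<in> Pup \<xi>"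
  shows "phi_star \<xi> \<phi> ch \<le> integral\<^sup>L \<mu> ch - \<phi> \<mu>"
proof -
  obtain B where "\<forall>\<nu>\<in>Pup \<xi>. \<bar>\<phi> \<nu>\<bar> \<le> B" using phi_bounded by blast
  then have "- Kbound - B \<le> integral\<^sup>L \<nu> ch - \<phi> \<nu>" if "\<nu> \<in> Pup \<xi>" for \<nu>
    using Pup_integral_bounded[OF that ch] that by fastforce
  then have "bdd_below ((\<lambda>\<mu>. integral\<^sup>L \<mu> ch - \<phi> \<mu>) ` Pup \<xi>)" by (rule bdd_belowI2)
  then show ?thesis unfolding phi_star_def using \<mu> by (rule cINF_lower)
qed

lemma phi_star_greatest:
  "(\<And>\<mu>. \<mu> \<in> Pup \<xi> \<Longrightarrow> c \<le> integral\<^sup>L \<mu> ch - \<phi> \<mu>) \<Longrightarrow> c \<le> phi_star \<xi> \<phi> ch"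
  unfolding phi_star_def by (rule cINF_greatest[OF Pup_nonempty])

text \<open>Averaging the defining inequality of \<open>phi_star\<close> over \<eta> produces the
  integral of \<open>ch\<close> against the barycentre; replacing the barycentre by F costs at most
  their distance.\<close>

lemma weak_duality:
  assumes \<eta>: "\<eta> \<in> PP \<xi>" and F: "F \<in> Lip_functionals" and ch: "ch \<in> Lip_ball \<xi>"
  shows "integral\<^sup>L \<eta> \<phi> - dM \<xi> (emb (Bar \<xi> \<eta>)) F \<le> F ch - phi_star \<xi> \<phi> ch"
proof -
  interpret prob_space \<eta> using \<eta> by (simp add: PP_def)
  have sp: "space \<eta> = Pup \<xi>" using \<eta> by (simp add: PP_def)
  obtain B where B: "\<forall>\<nu>\<in>Pup \<xi>. \<bar>\<phi> \<nu>\<bar> \<le> B" using phi_bounded by blast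
  have int: "integrable \<eta> \<phi>" "integrable \<eta> (\<lambda>\<nu>. integral\<^sup>L \<nu> ch)"
  proof -
    show "integrable \<eta> \<phi>"
      using phi_measurable B sp
      by (intro integrable_const_bound[of _ B]) (auto intro!: AE_I2 simp: PP_measurable_iff[OF \<eta>])
    have "(\<lambda>\<nu>. integral\<^sup>L \<nu> ch) \<in> borel_measurable (Pup_borel \<xi>)"
      using ch by (intro Pup_integral_measurable[of 1]) (auto simp: Lip_ball_def)
    then show "integrable \<eta> (\<lambda>\<nu>. integral\<^sup>L \<nu> ch)"
      using Pup_integral_bounded[OF _ ch] sp
      by (intro integrable_const_bound[of _ Kbound]) (auto intro!: AE_I2 simp: PP_measurable_iff[OF \<eta>])
  qed
  have "phi_star \<xi> \<phi> ch = (\<integral>\<nu>. phi_star \<xi> \<phi> ch \<partial>\<eta>)" by (simp add: prob_space)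
  also have "\<dots> \<le> (\<integral>\<nu>. integral\<^sup>L \<nu> ch - \<phi> \<nu> \<partial>\<eta>)"
    using int sp phi_star_lower[OF ch] by (intro integral_mono) auto
  also have "\<dots> = emb (Bar \<xi> \<eta>) ch - integral\<^sup>L \<eta> \<phi>"
    using int by (simp add: emb_Bar_apply[OF \<eta> ch])
  finally show ?thesis using dM_upper[OF emb_Bar[OF \<eta>] F ch] by linarith
qed

lemma PP_nonempty: "PP \<xi> \<noteq> {}"
proof -
  obtain \<mu> where "\<mu> \<in> Pup \<xi>" using Pup_nonempty by blast
  then have "\<exists>\<eta>\<in>PP \<xi>. \<forall>f\<in>borel_measurable (Pup_borel \<xi>). integral\<^sup>L \<eta> f = (\<Sum>\<nu>\<in>{\<mu>}. 1 * f \<nu> :: real)"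
    by (intro discrete_PP) auto
  then show ?thesis by blast
qed

lemma phi_bar_bdd: "F \<in> Lip_functionals \<Longrightarrow>
    bdd_above ((\<lambda>\<eta>. integral\<^sup>L \<eta> \<phi> - dM \<xi> (emb (Bar \<xi> \<eta>)) F) ` PP \<xi>)"
  using weak_duality[OF _ _ Lip_ball_zero] by (rule bdd_aboveI2)

lemma phi_bar_le: "F \<in> Lip_functionals \<Longrightarrow> ch \<in> Lip_ball \<xi> \<Longrightarrow>
    phi_bar \<xi> \<phi> F \<le> F ch - phi_star \<xi> \<phi> ch"
  unfolding phi_bar_def using weak_duality by (intro cSUP_least PP_nonempty)

text \<open>If c lies strictly below all dual values, one finite mixture beats c against all
  \<open>ch\<close> simultaneously. Being strictly below a value that involves the infimum
  \<open>phi_star\<close> provides, for each \<open>ch\<close>, some \<nu> that beats c, and minimax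
  exchanges the quantifiers. The level c is \<open>phi_bar\<close> itself for attainment, and a
  number above \<open>\<phi> \<mu>\<close> for the extension property.\<close>

lemma finite_dual_witness:
  assumes F: "F \<in> Lip_functionals"
    and c: "\<And>ch. ch \<in> Lip_ball \<xi> \<Longrightarrow> c < F ch - phi_star \<xi> \<phi> ch"
  obtains T w where "finite T" "T \<subseteq> Pup \<xi>" "\<And>\<nu>. \<nu> \<in> T \<Longrightarrow> 0 \<le> w \<nu>" "sum w T = 1"
    "\<And>ch. ch \<in> Lip0 \<Longrightarrow> c < F ch - (\<Sum>\<nu>\<in>T. w \<nu> * integral\<^sup>L \<nu> ch) + (\<Sum>\<nu>\<in>T. w \<nu> * \<phi> \<nu>)"
proof (rule minimax_weights[OF compact_Lip0 Pup_nonempty])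
  let ?g = "\<lambda>ch \<nu>. F ch - emb \<nu> ch + \<phi> \<nu>"
  show "continuous_on Lip0 (\<lambda>ch. ?g ch \<nu>)" if "\<nu> \<in> Pup \<xi>" for \<nu>
    using Lip_functionals_continuous[OF F] Lip_functionals_continuous[OF emb_Pup[OF that]]
    by (intro continuous_on_add continuous_on_diff continuous_on_const)
  show "\<exists>ch''\<in>Lip0. \<forall>\<nu>\<in>Pup \<xi>. ?g ch'' \<nu> \<le> t * ?g ch \<nu> + (1 - t) * ?g ch' \<nu>"
    if "ch \<in> Lip0" "ch' \<in> Lip0" "0 \<le> t" "t \<le> 1" for ch ch' t
  proof (intro bexI ballI)
    show "(\<lambda>x. t * ch x + (1 - t) * ch' x) \<in> Lip0" using that by (rule Lip0_mix)
    have lb: "ch \<in> Lip_ball \<xi>" "ch' \<in> Lip_ball \<xi>" using that by (auto simp: Lip0_def)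
    fix \<nu> assume \<nu>: "\<nu> \<in> Pup \<xi>"
    show "?g (\<lambda>x. t * ch x + (1 - t) * ch' x) \<nu> \<le> t * ?g ch \<nu> + (1 - t) * ?g ch' \<nu>"
      unfolding Lip_functionals_mix[OF F lb that(3,4)] Lip_functionals_mix[OF emb_Pup[OF \<nu>] lb that(3,4)]
      by (simp add: algebra_simps)
  qed
  show "\<exists>\<nu>\<in>Pup \<xi>. c < ?g ch \<nu>" if "ch \<in> Lip0" for ch
  proof (rule ccontr)
    assume "\<not> ?thesis"
    then have "F ch - c \<le> phi_star \<xi> \<phi> ch"
      by (intro phi_star_greatest) (force simp: emb_def)
    moreover have "ch \<in> Lip_ball \<xi>" using that by (simp add: Lip0_def)
    ultimately show False using c by force
  qed
  fix T and w :: "(real^'n^'n) measure \<Rightarrow> real"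
  assume T: "finite T" "T \<subseteq> Pup \<xi>" "\<And>\<nu>. \<nu> \<in> T \<Longrightarrow> 0 \<le> w \<nu>" "sum w T = 1"
    and gt: "\<And>ch. ch \<in> Lip0 \<Longrightarrow> c < (\<Sum>\<nu>\<in>T. w \<nu> * ?g ch \<nu>)"
  have "(\<Sum>\<nu>\<in>T. w \<nu> * ?g ch \<nu>) = F ch - (\<Sum>\<nu>\<in>T. w \<nu> * integral\<^sup>L \<nu> ch) + (\<Sum>\<nu>\<in>T. w \<nu> * \<phi> \<nu>)" for ch
    using T(4) by (simp add: distrib_left right_diff_distrib sum.distrib sum_subtractf
        sum_distrib_right[symmetric] emb_def)
  then show thesis using that[OF T] gt by simp
qed

text \<open>Equality and attainment come together: if no dual value equalled \<open>phi_bar\<close>,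
  all would lie strictly above it, and the finite witness would be an \<eta> whose primal value
  exceeds the supremum.\<close>

lemma strong_duality:
  assumes F: "F \<in> Lip_functionals"
  shows "\<exists>ch\<in>Lip_ball \<xi>. phi_bar \<xi> \<phi> F = F ch - phi_star \<xi> \<phi> ch"
proof (rule ccontr)
  assume "\<not> ?thesis"
  then have "phi_bar \<xi> \<phi> F < F ch - phi_star \<xi> \<phi> ch" if "ch \<in> Lip_ball \<xi>" for ch
    using phi_bar_le[OF F that] that by force
  then obtain T w where T: "finite T" "T \<subseteq> Pup \<xi>" "\<And>\<nu>. \<nu> \<in> T \<Longrightarrow> 0 \<le> w \<nu>" "sum w T = 1"
    and gt: "\<And>ch. ch \<in> Lip0 \<Longrightarrow>
      phi_bar \<xi> \<phi> F < F ch - (\<Sum>\<nu>\<in>T. w \<nu> * integral\<^sup>L \<nu> ch) + (\<Sum>\<nu>\<in>T. w \<nu> * \<phi> \<nu>)"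
    by (rule finite_dual_witness[OF F]) blast+
  obtain \<eta> where \<eta>: "\<eta> \<in> PP \<xi>"
    and int: "\<And>f. f \<in> borel_measurable (Pup_borel \<xi>) \<Longrightarrow> integral\<^sup>L \<eta> f = (\<Sum>\<nu>\<in>T. w \<nu> * f \<nu> :: real)"
    using discrete_PP[OF T] by blast
  define G where "G ch = F ch - emb (Bar \<xi> \<eta>) ch" for ch
  have G: "G ch = F ch - (\<Sum>\<nu>\<in>T. w \<nu> * integral\<^sup>L \<nu> ch)" if "ch \<in> Lip_ball \<xi>" for ch
  proof -
    have "(\<lambda>\<nu>. integral\<^sup>L \<nu> ch) \<in> borel_measurable (Pup_borel \<xi>)"
      using that by (intro Pup_integral_measurable[of 1]) (auto simp: Lip_ball_def)
    then show ?thesis using int by (simp add: G_def emb_Bar_apply[OF \<eta> that])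
  qed
  \<comment> \<open>A minimiser of G keeps the inequality strict, which could otherwise degrade to a
    weak one in passing to the supremum that defines \<open>dM\<close>.\<close>
  have "continuous_on Lip0 G"
    unfolding G_def using F emb_Bar[OF \<eta>] by (intro continuous_on_diff Lip_functionals_continuous)
  moreover have "Lip0 \<noteq> {}" using Lip0_restrict[OF Lip_ball_zero] by blast
  ultimately obtain ch0 where ch0: "ch0 \<in> Lip0" "\<And>ch. ch \<in> Lip0 \<Longrightarrow> G ch0 \<le> G ch"
    using continuous_attains_inf[OF compact_Lip0] by metis
  have "dM \<xi> (emb (Bar \<xi> \<eta>)) F \<le> - G ch0"
  proof (rule dM_least)
    fix ch assume ch: "ch \<in> Lip_ball \<xi>"
    let ?r = "\<lambda>x. if x \<in> Kxi \<xi> then ch x else 0"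
    have r: "?r \<in> Lip0" "?r \<in> Lip_ball \<xi>" using Lip0_restrict[OF ch] by (auto simp: Lip0_def)
    have "emb (Bar \<xi> \<eta>) ?r = emb (Bar \<xi> \<eta>) ch" "F ?r = F ch"
      by (rule Lip_functionals_cong[OF emb_Bar[OF \<eta>] r(2) ch], simp)
        (rule Lip_functionals_cong[OF F r(2) ch], simp)
    then show "emb (Bar \<xi> \<eta>) ch - F ch \<le> - G ch0" using ch0(2)[OF r(1)] by (simp add: G_def)
  qed
  moreover have "phi_bar \<xi> \<phi> F < G ch0 + integral\<^sup>L \<eta> \<phi>"
    using gt[OF ch0(1)] G[of ch0] ch0(1) int[OF phi_measurable] by (simp add: Lip0_def)
  moreover have "integral\<^sup>L \<eta> \<phi> - dM \<xi> (emb (Bar \<xi> \<eta>)) F \<le> phi_bar \<xi> \<phi> F"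
    unfolding phi_bar_def by (rule cSUP_upper[OF \<eta> phi_bar_bdd[OF F]])
  ultimately show False by linarith
qed

text \<open>The optimal \<open>ch\<close> for G is a competitor for F, and the two
  \<open>phi_star\<close> terms cancel.\<close>

lemma phi_bar_lipschitz:
  assumes F: "F \<in> Lip_functionals" and G: "G \<in> Lip_functionals"
  shows "\<bar>phi_bar \<xi> \<phi> F - phi_bar \<xi> \<phi> G\<bar> \<le> dM \<xi> F G"
proof -
  have "phi_bar \<xi> \<phi> F - phi_bar \<xi> \<phi> G \<le> dM \<xi> F G"
    if F: "F \<in> Lip_functionals" and G: "G \<in> Lip_functionals" for F G
  proof -
    obtain ch where "ch \<in> Lip_ball \<xi>" "phi_bar \<xi> \<phi> G = G ch - phi_star \<xi> \<phi> ch"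
      using strong_duality[OF G] by blast
    then show ?thesis using phi_bar_le[OF F, of ch] dM_upper[OF F G, of ch] by simp
  qed
  from this[OF F G] this[OF G F] show ?thesis by (simp add: dM_commute[OF F G])
qed

lemma phi_bar_concave:
  assumes F: "F \<in> Lip_functionals" and G: "G \<in> Lip_functionals" and t: "0 \<le> t" "t \<le> 1"
  shows "t * phi_bar \<xi> \<phi> F + (1 - t) * phi_bar \<xi> \<phi> G \<le> phi_bar \<xi> \<phi> (\<lambda>ch. t * F ch + (1 - t) * G ch)"
proof -
  obtain ch where ch: "ch \<in> Lip_ball \<xi>"
    and eq: "phi_bar \<xi> \<phi> (\<lambda>ch. t * F ch + (1 - t) * G ch) = t * F ch + (1 - t) * G ch - phi_star \<xi> \<phi> ch"
    using strong_duality[OF Lip_functionals_convex[OF F G t]] by blast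
  have "t * phi_bar \<xi> \<phi> F + (1 - t) * phi_bar \<xi> \<phi> G
      \<le> t * (F ch - phi_star \<xi> \<phi> ch) + (1 - t) * (G ch - phi_star \<xi> \<phi> ch)"
    using phi_bar_le[OF F ch] phi_bar_le[OF G ch] t by (intro add_mono mult_left_mono) auto
  then show ?thesis unfolding eq by (simp add: algebra_simps)
qed

text \<open>A Dirac mass at \<mu> would be the primal argument; the dual minimiser gives the bound
  directly from the definition of \<open>phi_star\<close>.\<close>

lemma phi_bar_ge:
  assumes \<mu>: "\<mu> \<in> Pup \<xi>"
  shows "\<phi> \<mu> \<le> phi_bar \<xi> \<phi> (emb \<mu>)"
proof -
  obtain ch where ch: "ch \<in> Lip_ball \<xi>" "phi_bar \<xi> \<phi> (emb \<mu>) = emb \<mu> ch - phi_star \<xi> \<phi> ch"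
    using strong_duality[OF emb_Pup[OF \<mu>]] by blast
  then show ?thesis using phi_star_lower[OF ch(1) \<mu>] by (simp add: emb_def)
qed

end

section \<open>Transport to a chain\<close>

text \<open>The finite Jensen inequality: one index is split off and the remaining weights are
  rescaled to total one, except when they all vanish. The points are functions, so mixtures are
  formed pointwise.\<close>

lemma concave_on_functions_sum:
  fixes \<Phi> :: "('k \<Rightarrow> real) \<Rightarrow> real" and m :: "'i \<Rightarrow> 'k \<Rightarrow> real"
  assumes conv: "\<And>m m' t. m \<in> W \<Longrightarrow> m' \<in> W \<Longrightarrow> 0 \<le> t \<Longrightarrow> t \<le> 1 \<Longrightarrow>
      (\<lambda>k. t * m k + (1 - t) * m' k) \<in> W"
    and conc: "\<And>m m' t. m \<in> W \<Longrightarrow> m' \<in> W \<Longrightarrow> 0 \<le> t \<Longrightarrow> t \<le> 1 \<Longrightarrow>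
      t * \<Phi> m + (1 - t) * \<Phi> m' \<le> \<Phi> (\<lambda>k. t * m k + (1 - t) * m' k)"
    and "finite T" "T \<noteq> {}" "\<And>i. i \<in> T \<Longrightarrow> 0 \<le> w i" "sum w T = 1" "\<And>i. i \<in> T \<Longrightarrow> m i \<in> W"
  shows "(\<lambda>k. \<Sum>i\<in>T. w i * m i k) \<in> W \<and> (\<Sum>i\<in>T. w i * \<Phi> (m i)) \<le> \<Phi> (\<lambda>k. \<Sum>i\<in>T. w i * m i k)"
  using assms(3-7)
proof (induction T arbitrary: w rule: finite_ne_induct)
  case (singleton i)
  then show ?case by simp
next
  case (insert i T)
  define s where "s = sum w T"
  have s: "w i = 1 - s" "0 \<le> s" "0 \<le> w i"
    using insert by (auto simp: s_def intro!: sum_nonneg)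
  show ?case
  proof (cases "s = 0")
    case True
    then have "w j = 0" if "j \<in> T" for j
      using that insert.hyps insert.prems(1) by (simp add: s_def sum_nonneg_eq_0_iff)
    then show ?thesis using insert s True by simp
  next
    case False
    define w' where "w' j = w j / s" for j
    define m' where "m' = (\<lambda>k. \<Sum>j\<in>T. w' j * m j k)"
    have IH: "m' \<in> W \<and> (\<Sum>j\<in>T. w' j * \<Phi> (m j)) \<le> \<Phi> m'"
      unfolding m'_def
      by (rule insert.IH) (use insert.prems s False in \<open>auto simp: w'_def sum_divide_distrib[symmetric] s_def\<close>)
    have scale: "s * (\<Sum>j\<in>T. w' j * h j) = (\<Sum>j\<in>T. w j * h j)" for h :: "'i \<Rightarrow> real"
      using False by (simp add: sum_distrib_left w'_def)
    have eq: "(\<lambda>k. \<Sum>j\<in>insert i T. w j * m j k) = (\<lambda>k. w i * m i k + (1 - w i) * m' k)"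
      using insert.hyps scale s(1) by (simp add: m'_def)
    have "(\<Sum>j\<in>insert i T. w j * \<Phi> (m j)) = w i * \<Phi> (m i) + s * (\<Sum>j\<in>T. w' j * \<Phi> (m j))"
      using insert.hyps scale by simp
    also have "\<dots> \<le> w i * \<Phi> (m i) + (1 - w i) * \<Phi> m'"
      using IH s by (simp add: mult_left_mono)
    also have "\<dots> \<le> \<Phi> (\<lambda>k. w i * m i k + (1 - w i) * m' k)"
      using s IH insert.prems by (intro conc) auto
    finally have "(\<Sum>j\<in>insert i T. w j * \<Phi> (m j)) \<le> \<Phi> (\<lambda>k. w i * m i k + (1 - w i) * m' k)" .
    moreover have "(\<lambda>k. w i * m i k + (1 - w i) * m' k) \<in> W"
      using s IH insert.prems by (intro conv) auto
    ultimately show ?thesis unfolding eq by blast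
  qed
qed

text \<open>Ties go to the smallest index, so that exactly one index has weight one.\<close>

definition nearest :: "(nat \<Rightarrow> 'a \<Rightarrow> real) \<Rightarrow> nat \<Rightarrow> nat \<Rightarrow> 'a \<Rightarrow> real" where
  "nearest h N k x = (if k < N \<and> (\<forall>l<N. h k x \<le> h l x) \<and> (\<forall>l<k. h k x < h l x) then 1 else 0)"

lemma sum_nearest:
  assumes "0 < N"
  obtains j where "j < N" "\<And>l. l < N \<Longrightarrow> h j x \<le> h l x"
    "\<And>v. (\<Sum>k<N. nearest h N k x * v k) = v j"
proof -
  let ?P = "\<lambda>k. k < N \<and> (\<forall>l<N. h k x \<le> h l x)"
  define j where "j = (LEAST k. ?P k)"
  have "\<exists>k\<in>{..<N}. \<forall>l\<in>{..<N}. h k x \<le> h l x"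
    using assms by (intro bexI[of _ "arg_min_on (\<lambda>k. h k x) {..<N}"] ballI arg_min_least arg_min_if_finite(1)) auto
  then have "\<exists>k. ?P k" by auto
  then have j: "?P j" unfolding j_def by (rule LeastI_ex)
  have below: "h j x < h l x" if "l < j" for l
  proof (rule ccontr)
    assume "\<not> h j x < h l x"
    then have "h l x \<le> h j x" by simp
    then have "?P l" using j that by (meson order_trans less_trans)
    then show False using not_less_Least[of l ?P] that by (simp add: j_def)
  qed
  have "nearest h N k x = (if k = j then 1 else 0)" for k
  proof (cases k j rule: linorder_cases)
    case less
    then show ?thesis using below[of k] j by (force simp: nearest_def)
  next
    case equal
    then show ?thesis using j below by (simp add: nearest_def)
  next
    case greater
    then show ?thesis using j by (force simp: nearest_def)
  qed
  then have "(\<Sum>k<N. nearest h N k x * v k) = v j" for v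
    using j by (simp add: if_distrib[of "\<lambda>c. c * _"] sum.delta cong: if_cong)
  then show thesis using that[of j] j by blast
qed

text \<open>Being minimal is a closed condition and winning all ties is an open one.\<close>

lemma nearest_measurable:
  fixes h :: "nat \<Rightarrow> 'a::topological_space \<Rightarrow> real"
  assumes "\<And>k. continuous_on UNIV (h k)"
  shows "nearest h N k \<in> borel_measurable borel"
proof -
  let ?A = "{x. k < N \<and> (\<forall>l<N. h k x \<le> h l x) \<and> (\<forall>l<k. h k x < h l x)}"
  have "?A = {x. k < N} \<inter> ((\<Inter>l\<in>{..<N}. {x. h k x \<le> h l x}) \<inter> (\<Inter>l\<in>{..<k}. {x. h k x < h l x}))"
    by auto
  moreover have "closed (\<Inter>l\<in>{..<N}. {x. h k x \<le> h l x})"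
    using assms by (intro closed_INT ballI closed_Collect_le)
  moreover have "open (\<Inter>l\<in>{..<k}. {x. h k x < h l x})"
    using assms by (intro open_INT ballI open_Collect_less) auto
  ultimately have "?A \<in> sets borel" by (cases "k < N") auto
  then have "(indicator ?A :: 'a \<Rightarrow> real) \<in> borel_measurable borel"
    by (rule borel_measurable_indicator)
  moreover have "nearest h N k = indicator ?A" by (rule ext) (simp add: nearest_def indicator_def)
  ultimately show ?thesis by metis
qed

locale concave_functional = lipschitz_functional \<xi> \<phi>
  for \<xi> :: "real^'n::finite^'n \<Rightarrow> real" and \<phi> :: "(real^'n^'n) measure \<Rightarrow> real" +
  assumes pc: "pre_concave \<xi> \<phi>"

locale chain_functional = concave_functional \<xi> \<phi>
  for \<xi> :: "real^'n::finite^'n \<Rightarrow> real" and \<phi> :: "(real^'n^'n) measure \<Rightarrow> real" +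
  fixes M :: nat and a :: "nat \<Rightarrow> real^'n^'n"
  assumes chain: "\<And>k. k \<le> M \<Longrightarrow> psd (a k) \<and> norm (a k) \<le> 1"
    and incr: "\<And>k. k < M \<Longrightarrow> psd (a (Suc k) - a k)"
begin

definition pt :: "nat \<Rightarrow> real^'n^'n" where "pt k = grad \<xi> (a k)"

definition weights :: "(nat \<Rightarrow> real) set" where
  "weights = {m. (\<forall>k. 0 \<le> m k) \<and> (\<Sum>k<Suc M. m k) = 1}"

text \<open>The sum of the masses \<open>m k\<close> placed at the points \<open>pt k\<close>,
  picked as an element of \<open>Pup\<close> with the right integrals; \<open>chain_law\<close>
  shows that one exists.\<close>

definition law :: "(nat \<Rightarrow> real) \<Rightarrow> (real^'n^'n) measure" where
  "law m = (SOME \<nu>. \<nu> \<in> Pup \<xi> \<and> (\<forall>f\<in>borel_measurable (Kspace \<xi>).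
    integral\<^sup>L \<nu> f = (\<Sum>k<Suc M. m k * f (pt k) :: real)))"

lemma pt_in_Kxi: "k < Suc M \<Longrightarrow> pt k \<in> Kxi \<xi>"
  using chain[of k] by (auto simp: pt_def Kxi_def)

lemma law_props:
  assumes "m \<in> weights"
  shows "law m \<in> Pup \<xi> \<and> (\<forall>f\<in>borel_measurable (Kspace \<xi>).
    integral\<^sup>L (law m) f = (\<Sum>k<Suc M. m k * f (pt k) :: real))"
proof -
  have "\<exists>\<nu>. \<nu> \<in> Pup \<xi> \<and> (\<forall>f\<in>borel_measurable (Kspace \<xi>).
      integral\<^sup>L \<nu> f = (\<Sum>k<Suc M. m k * f (pt k) :: real))"
    using chain_law[of M a m] chain incr assms unfolding weights_def pt_def by blast
  then show ?thesis unfolding law_def by (rule someI_ex)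
qed

lemma law_Pup: "m \<in> weights \<Longrightarrow> law m \<in> Pup \<xi>"
  using law_props by blast

lemma integral_law:
  "m \<in> weights \<Longrightarrow> f \<in> borel_measurable (Kspace \<xi>) \<Longrightarrow>
    integral\<^sup>L (law m) f = (\<Sum>k<Suc M. m k * f (pt k) :: real)"
  using law_props by blast

text \<open>Pre-concavity recognises a mixture by its values on sets, whereas \<open>law\<close> is
  described by its integrals; this translates between the two.\<close>

lemma measure_law:
  assumes m: "m \<in> weights" and A: "A \<in> sets (Kspace \<xi>)"
  shows "measure (law m) A = (\<Sum>k<Suc M. m k * indicator A (pt k))"
proof -
  have "A \<in> sets (law m)" using A Pup_sets[OF law_Pup[OF m]] by simp
  then have "measure (law m) A = integral\<^sup>L (law m) (indicator A)"
    by (simp add: Int_absorb2 sets.sets_into_space)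
  also have "\<dots> = (\<Sum>k<Suc M. m k * indicator A (pt k))"
    using A by (intro integral_law[OF m]) simp
  finally show ?thesis .
qed

lemma weights_mix:
  assumes "m \<in> weights" "m' \<in> weights" "0 \<le> t" "t \<le> 1"
  shows "(\<lambda>k. t * m k + (1 - t) * m' k) \<in> weights"
proof -
  have "(\<Sum>k<Suc M. t * m k + (1 - t) * m' k) = t * (\<Sum>k<Suc M. m k) + (1 - t) * (\<Sum>k<Suc M. m' k)"
    by (simp only: sum.distrib sum_distrib_left)
  also have "\<dots> = 1" using assms(1,2) by (simp only: weights_def mem_Collect_eq) simp
  finally show ?thesis using assms by (simp add: weights_def)
qed

lemma law_concave:
  assumes m: "m \<in> weights" "m' \<in> weights" and t: "0 \<le> t" "t \<le> 1"
  shows "t * \<phi> (law m) + (1 - t) * \<phi> (law m') \<le> \<phi> (law (\<lambda>k. t * m k + (1 - t) * m' k))"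
proof -
  have mix: "(\<lambda>k. t * m k + (1 - t) * m' k) \<in> weights" using weights_mix[OF m t] .
  have "measure (law (\<lambda>k. t * m k + (1 - t) * m' k)) A = t * measure (law m) A + (1 - t) * measure (law m') A"
    if "A \<in> sets (Kspace \<xi>)" for A
    unfolding measure_law[OF mix that] measure_law[OF m(1) that] measure_law[OF m(2) that]
      sum_distrib_left sum.distrib[symmetric]
    by (intro sum.cong) (auto simp: algebra_simps)
  then show ?thesis
    using pc law_Pup[OF m(1)] law_Pup[OF m(2)] law_Pup[OF mix] t unfolding pre_concave_def by blast
qed

text \<open>\<open>\<kappa> k x\<close> is the share of the mass at x that is sent to
  \<open>pt k\<close>. The bounds hold at every index and point, which gives integrability for any
  k; the shares add up to one on K, where the measures live.\<close>

definition kernels :: "(nat \<Rightarrow> real^'n^'n \<Rightarrow> real) set" where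
  "kernels = {\<kappa>. (\<forall>k. \<kappa> k \<in> borel_measurable (Kspace \<xi>)) \<and> (\<forall>k x. 0 \<le> \<kappa> k x) \<and> (\<forall>k x. \<kappa> k x \<le> 1) \<and>
    (\<forall>x\<in>Kxi \<xi>. (\<Sum>k<Suc M. \<kappa> k x) = 1)}"

lemma kernel_integrable:
  assumes "\<kappa> \<in> kernels" "\<nu> \<in> Pup \<xi>" "f \<in> borel_measurable (Kspace \<xi>)"
    "\<And>x. x \<in> Kxi \<xi> \<Longrightarrow> \<bar>f x\<bar> \<le> B"
  shows "integrable \<nu> (\<lambda>x. \<kappa> k x * f x)"
proof (rule finite_K_integrable[OF Pup_finite_K[OF assms(2)]])
  show "(\<lambda>x. \<kappa> k x * f x) \<in> borel_measurable (Kspace \<xi>)"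
    using assms by (intro borel_measurable_times) (simp_all add: kernels_def)
  fix x assume "x \<in> Kxi \<xi>"
  then have "\<bar>\<kappa> k x\<bar> * \<bar>f x\<bar> \<le> 1 * B"
    using assms by (intro mult_mono) (auto simp: kernels_def)
  then show "\<bar>\<kappa> k x * f x\<bar> \<le> B" by (simp add: abs_mult)
qed

lemma dist_pt: 
  assumes "k < Suc M"
  shows "(\<lambda>x. dist x (pt k)) \<in> borel_measurable (Kspace \<xi>)"
    "\<And>x. x \<in> Kxi \<xi> \<Longrightarrow> \<bar>dist x (pt k)\<bar> \<le> Kbound"
  using dist_le_Kbound[OF _ pt_in_Kxi[OF assms]]
  by (auto intro!: borel_measurable_continuous_on_restrict continuous_intros)

definition cost :: "(nat \<Rightarrow> real^'n^'n \<Rightarrow> real) \<Rightarrow> (real^'n^'n) measure \<Rightarrow> real" where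
  "cost \<kappa> \<nu> = (\<Sum>k<Suc M. (\<integral>x. \<kappa> k x * dist x (pt k) \<partial>\<nu>))"

definition pushed :: "(nat \<Rightarrow> real^'n^'n \<Rightarrow> real) \<Rightarrow> (real^'n^'n) measure \<Rightarrow> nat \<Rightarrow> real" where
  "pushed \<kappa> \<nu> k = (\<integral>x. \<kappa> k x \<partial>\<nu>)"

lemma pushed_weights:
  assumes \<kappa>: "\<kappa> \<in> kernels" and \<nu>: "\<nu> \<in> Pup \<xi>"
  shows "pushed \<kappa> \<nu> \<in> weights"
proof -
  interpret prob_space \<nu> using Pup_prob_space[OF \<nu>] .
  have int: "integrable \<nu> (\<kappa> k)" for k
    using kernel_integrable[OF \<kappa> \<nu>, of "\<lambda>_. 1" 1 k] by simp
  have "(\<Sum>k<Suc M. pushed \<kappa> \<nu> k) = (\<integral>x. (\<Sum>k<Suc M. \<kappa> k x) \<partial>\<nu>)"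
    unfolding pushed_def by (rule Bochner_Integration.integral_sum[symmetric]) (rule int)
  also have "\<dots> = (\<integral>x. 1 \<partial>\<nu>)"
    using \<kappa> Pup_space[OF \<nu>] by (intro Bochner_Integration.integral_cong refl) (simp only: kernels_def mem_Collect_eq)
  finally have "(\<Sum>k<Suc M. pushed \<kappa> \<nu> k) = 1" by (simp only: prob_space lebesgue_integral_const) simp
  moreover have "0 \<le> pushed \<kappa> \<nu> k" for k
    using \<kappa> unfolding pushed_def by (intro integral_nonneg_AE) (auto simp: kernels_def)
  ultimately show ?thesis by (simp only: weights_def) blast
qed

text \<open>The easy inequality of optimal transport: a kernel yields a coupling, and a 1-Lipschitz
  function changes by at most the distance travelled.\<close>

lemma dP_pushed:
  assumes \<kappa>: "\<kappa> \<in> kernels" and \<nu>: "\<nu> \<in> Pup \<xi>"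
  shows "dP \<xi> \<nu> (law (pushed \<kappa> \<nu>)) \<le> cost \<kappa> \<nu>"
proof (rule dP_least)
  fix ch assume ch: "ch \<in> Lip_ball \<xi>"
  have int: "integrable \<nu> (\<kappa> k)" "integrable \<nu> (\<lambda>x. \<kappa> k x * ch x)" for k
    using kernel_integrable[OF \<kappa> \<nu>, of "\<lambda>_. 1" 1 k]
      kernel_integrable[OF \<kappa> \<nu> Lip_ball_measurable[OF ch] Lip_ball_bounded[OF ch]] by simp_all
  have "integral\<^sup>L \<nu> ch = (\<integral>x. (\<Sum>k<Suc M. \<kappa> k x * ch x) \<partial>\<nu>)"
    using \<kappa> Pup_space[OF \<nu>]
    by (intro Bochner_Integration.integral_cong refl)
      (simp only: kernels_def mem_Collect_eq sum_distrib_right[symmetric] mult_1_left)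
  also have "\<dots> = (\<Sum>k<Suc M. (\<integral>x. \<kappa> k x * ch x \<partial>\<nu>))"
    by (rule Bochner_Integration.integral_sum) (rule int)
  finally have "integral\<^sup>L \<nu> ch - integral\<^sup>L (law (pushed \<kappa> \<nu>)) ch
      = (\<Sum>k<Suc M. (\<integral>x. \<kappa> k x * ch x \<partial>\<nu>) - pushed \<kappa> \<nu> k * ch (pt k))"
    unfolding integral_law[OF pushed_weights[OF \<kappa> \<nu>] Lip_ball_measurable[OF ch]]
    by (simp only: sum_subtractf)
  also have "\<dots> \<le> cost \<kappa> \<nu>"
    unfolding cost_def
  proof (rule sum_mono)
    fix k assume "k \<in> {..<Suc M}"
    then have k: "k < Suc M" by simp
    have "(\<integral>x. \<kappa> k x * ch x \<partial>\<nu>) - pushed \<kappa> \<nu> k * ch (pt k) = (\<integral>x. \<kappa> k x * ch x - \<kappa> k x * ch (pt k) \<partial>\<nu>)"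
      using int by (simp add: pushed_def)
    also have "\<dots> \<le> (\<integral>x. \<kappa> k x * dist x (pt k) \<partial>\<nu>)"
    proof (rule integral_mono)
      show "integrable \<nu> (\<lambda>x. \<kappa> k x * dist x (pt k))"
        by (rule kernel_integrable[OF \<kappa> \<nu> dist_pt[OF k]])
      fix x assume "x \<in> space \<nu>"
      then have "ch x - ch (pt k) \<le> dist x (pt k)"
        using ch pt_in_Kxi[OF k] Pup_space[OF \<nu>] by (force simp: Lip_ball_def)
      then have "\<kappa> k x * (ch x - ch (pt k)) \<le> \<kappa> k x * dist x (pt k)"
        using \<kappa> by (intro mult_left_mono) (auto simp: kernels_def)
      then show "\<kappa> k x * ch x - \<kappa> k x * ch (pt k) \<le> \<kappa> k x * dist x (pt k)"
        by (simp add: right_diff_distrib)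
    qed (use int in simp)
    finally show "(\<integral>x. \<kappa> k x * ch x \<partial>\<nu>) - pushed \<kappa> \<nu> k * ch (pt k) \<le> (\<integral>x. \<kappa> k x * dist x (pt k) \<partial>\<nu>)" .
  qed
  finally show "integral\<^sup>L \<nu> ch - integral\<^sup>L (law (pushed \<kappa> \<nu>)) ch \<le> cost \<kappa> \<nu>" .
qed

lemma kernels_mix:
  assumes \<kappa>: "\<kappa> \<in> kernels" "\<kappa>' \<in> kernels" and t: "0 \<le> t" "t \<le> 1"
  shows "(\<lambda>k x. t * \<kappa> k x + (1 - t) * \<kappa>' k x) \<in> kernels"
proof -
  have "(\<Sum>k<Suc M. t * \<kappa> k x + (1 - t) * \<kappa>' k x) = 1" if "x \<in> Kxi \<xi>" for x
  proof -
    have "(\<Sum>k<Suc M. t * \<kappa> k x + (1 - t) * \<kappa>' k x) = t * (\<Sum>k<Suc M. \<kappa> k x) + (1 - t) * (\<Sum>k<Suc M. \<kappa>' k x)"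
      by (simp only: sum.distrib sum_distrib_left)
    also have "\<dots> = 1" using \<kappa> that by (simp only: kernels_def mem_Collect_eq) simp
    finally show ?thesis .
  qed
  moreover have "t * \<kappa> k x + (1 - t) * \<kappa>' k x \<le> 1" "0 \<le> t * \<kappa> k x + (1 - t) * \<kappa>' k x" for k x
    using \<kappa> t convex_bound_le[of "\<kappa> k x" 1 "\<kappa>' k x" t "1 - t"] by (auto simp: kernels_def)
  moreover have "(\<lambda>x. t * \<kappa> k x + (1 - t) * \<kappa>' k x) \<in> borel_measurable (Kspace \<xi>)" for k
    using \<kappa> by (intro borel_measurable_add borel_measurable_times borel_measurable_const)
      (simp_all add: kernels_def)
  ultimately show ?thesis unfolding kernels_def by blast
qed

text \<open>Linearity in the kernel is what makes the payoff in \<open>mixture_le_chain\<close>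
  affine in it, so that concavelikeness there is an equality.\<close>

lemma pushed_mix:
  assumes \<kappa>: "\<kappa> \<in> kernels" "\<kappa>' \<in> kernels" and \<nu>: "\<nu> \<in> Pup \<xi>"
  shows "pushed (\<lambda>k x. t * \<kappa> k x + (1 - t) * \<kappa>' k x) \<nu> k = t * pushed \<kappa> \<nu> k + (1 - t) * pushed \<kappa>' \<nu> k"
    and "cost (\<lambda>k x. t * \<kappa> k x + (1 - t) * \<kappa>' k x) \<nu> = t * cost \<kappa> \<nu> + (1 - t) * cost \<kappa>' \<nu>"
proof -
  have "integrable \<nu> (\<kappa> k)" "integrable \<nu> (\<kappa>' k)"
    using kernel_integrable[OF \<kappa>(1) \<nu>, of "\<lambda>_. 1" 1 k] kernel_integrable[OF \<kappa>(2) \<nu>, of "\<lambda>_. 1" 1 k]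
    by simp_all
  then show "pushed (\<lambda>k x. t * \<kappa> k x + (1 - t) * \<kappa>' k x) \<nu> k = t * pushed \<kappa> \<nu> k + (1 - t) * pushed \<kappa>' \<nu> k"
    by (simp add: pushed_def)
  have "(\<integral>x. (t * \<kappa> k x + (1 - t) * \<kappa>' k x) * dist x (pt k) \<partial>\<nu>) =
      t * (\<integral>x. \<kappa> k x * dist x (pt k) \<partial>\<nu>) + (1 - t) * (\<integral>x. \<kappa>' k x * dist x (pt k) \<partial>\<nu>)"
    if "k < Suc M" for k
    using kernel_integrable[OF \<kappa>(1) \<nu> dist_pt[OF that]] kernel_integrable[OF \<kappa>(2) \<nu> dist_pt[OF that]]
    by (simp add: distrib_right mult.assoc)
  then show "cost (\<lambda>k x. t * \<kappa> k x + (1 - t) * \<kappa>' k x) \<nu> = t * cost \<kappa> \<nu> + (1 - t) * cost \<kappa>' \<nu>"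
    unfolding cost_def sum_distrib_left sum.distrib[symmetric] by (intro sum.cong) auto
qed

lemma nearest_kernel:
  assumes h: "\<And>k. continuous_on UNIV (h k)"
  shows "nearest h (Suc M) \<in> kernels"
proof -
  have "nearest h (Suc M) k \<in> borel_measurable (Kspace \<xi>)" for k
    using nearest_measurable[OF h] by (rule measurable_restrict_space1)
  moreover have "(\<Sum>k<Suc M. nearest h (Suc M) k x) = 1" for x
  proof -
    obtain j where "\<And>v. (\<Sum>k<Suc M. nearest h (Suc M) k x * v k) = v j"
      by (rule sum_nearest[of "Suc M" h x]) auto
    from this[of "\<lambda>_. 1"] show ?thesis by simp
  qed
  moreover have "0 \<le> nearest h (Suc M) k x" "nearest h (Suc M) k x \<le> 1" for k x
    by (auto simp: nearest_def)
  ultimately show ?thesis unfolding kernels_def by blast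
qed

text \<open>The cheapest transport to the chain, when landing at a point costs \<open>ch\<close> there, realises the
  McShane extension of \<open>ch\<close> from the chain.\<close>

lemma optimal_kernel:
  obtains \<kappa> g where "\<kappa> \<in> kernels"
    "\<And>x y. x \<in> Kxi \<xi> \<Longrightarrow> y \<in> Kxi \<xi> \<Longrightarrow> \<bar>g x - g y\<bar> \<le> dist x y"
    "\<And>k. k < Suc M \<Longrightarrow> g (pt k) \<le> ch (pt k)"
    "\<And>\<nu>. \<nu> \<in> Pup \<xi> \<Longrightarrow> cost \<kappa> \<nu> + (\<Sum>k<Suc M. pushed \<kappa> \<nu> k * ch (pt k)) = integral\<^sup>L \<nu> g"
proof -
  define h where "h k x = dist x (pt k) + ch (pt k)" for k x
  define g where "g x = Min ((\<lambda>k. h k x) ` {..<Suc M})" for x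
  have g_le: "g x \<le> h k x" if "k < Suc M" for k x
    unfolding g_def using that by (intro Min_le) auto
  have g_in: "\<exists>k<Suc M. g x = h k x" for x
  proof -
    have "g x \<in> (\<lambda>k. h k x) ` {..<Suc M}" unfolding g_def by (rule Min_in) auto
    then show ?thesis by auto
  qed
  have g_lip: "g x \<le> g y + dist x y" for x y
  proof -
    obtain k where k: "k < Suc M" "g y = h k y" using g_in by blast
    then show ?thesis using g_le[OF k(1), of x] dist_triangle[of x "pt k" y] by (simp add: h_def)
  qed
  have sum_h: "(\<Sum>k<Suc M. nearest h (Suc M) k x * h k x) = g x" for x
  proof -
    obtain j where j: "j < Suc M" "\<And>l. l < Suc M \<Longrightarrow> h j x \<le> h l x"
      "\<And>v. (\<Sum>k<Suc M. nearest h (Suc M) k x * v k) = v j"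
      by (rule sum_nearest[of "Suc M" h x]) auto
    have "g x = h j x" using g_in[of x] g_le[OF j(1), of x] j(2) by force
    then show ?thesis using j(3) by simp
  qed
  define \<kappa> where "\<kappa> = nearest h (Suc M)"
  show thesis
  proof (rule that[of \<kappa> g])
    show \<kappa>: "\<kappa> \<in> kernels"
      unfolding \<kappa>_def by (rule nearest_kernel) (unfold h_def, intro continuous_intros)
    show "\<bar>g x - g y\<bar> \<le> dist x y" for x y
      using g_lip[of x y] g_lip[of y x] by (simp add: dist_commute abs_le_iff)
    show "g (pt k) \<le> ch (pt k)" if "k < Suc M" for k
      using g_le[OF that, of "pt k"] by (simp add: h_def)
    fix \<nu> assume \<nu>: "\<nu> \<in> Pup \<xi>"
    have int: "integrable \<nu> (\<lambda>x. \<kappa> k x * dist x (pt k))" "integrable \<nu> (\<kappa> k)" if "k < Suc M" for k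
      using kernel_integrable[OF \<kappa> \<nu> dist_pt[OF that]] kernel_integrable[OF \<kappa> \<nu>, of "\<lambda>_. 1" 1 k]
      by simp_all
    have "cost \<kappa> \<nu> + (\<Sum>k<Suc M. pushed \<kappa> \<nu> k * ch (pt k)) = (\<Sum>k<Suc M. (\<integral>x. \<kappa> k x * h k x \<partial>\<nu>))"
      unfolding cost_def pushed_def sum.distrib[symmetric]
      using int by (intro sum.cong refl) (simp add: h_def distrib_left)
    also have "\<dots> = (\<integral>x. (\<Sum>k<Suc M. \<kappa> k x * h k x) \<partial>\<nu>)"
      using int by (intro Bochner_Integration.integral_sum[symmetric]) (simp add: h_def distrib_left)
    also have "\<dots> = integral\<^sup>L \<nu> g" by (simp only: \<kappa>_def sum_h)
    finally show "cost \<kappa> \<nu> + (\<Sum>k<Suc M. pushed \<kappa> \<nu> k * ch (pt k)) = integral\<^sup>L \<nu> g" .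
  qed
qed


text \<open>A game between a kernel, which wants cost plus distance from its image to
  \<open>law m\<close> to be small, and a function \<open>ch\<close>, which measures that distance.
  Against a known \<open>ch\<close> the kernel from \<open>optimal_kernel\<close> secures at least
  -D, by applying \<open>D\<close> to the McShane extension; minimax then gives one kernel that is
  good, up to e, against all \<open>ch\<close>.\<close>

lemma mixture_le_chain:
  assumes T: "finite T" "T \<subseteq> Pup \<xi>" "\<And>\<nu>. \<nu> \<in> T \<Longrightarrow> 0 \<le> w \<nu>" "sum w T = 1"
    and m: "m \<in> weights"
    and D: "\<And>ch. ch \<in> Lip_ball \<xi> \<Longrightarrow>
      (\<Sum>\<nu>\<in>T. w \<nu> * integral\<^sup>L \<nu> ch) - (\<Sum>k<Suc M. m k * ch (pt k)) \<le> D"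
  shows "(\<Sum>\<nu>\<in>T. w \<nu> * \<phi> \<nu>) \<le> \<phi> (law m) + D"
proof (rule field_le_epsilon)
  fix e :: real assume "0 < e"
  define C where "C \<kappa> = (\<Sum>\<nu>\<in>T. w \<nu> * cost \<kappa> \<nu>)" for \<kappa>
  define B where "B \<kappa> k = (\<Sum>\<nu>\<in>T. w \<nu> * pushed \<kappa> \<nu> k)" for \<kappa> k
  \<comment> \<open>Minus the cost of the kernel and minus the discrepancy, seen by
    \<open>ch\<close>, between its image and m. A value above -(D + e) for all \<open>ch\<close>
    thus bounds cost plus distance by D + e; the slack e turns -D into the strict level that minimax
    asks for.\<close>
  define f where "f ch \<kappa> = (\<Sum>k<Suc M. m k * ch (pt k)) - (C \<kappa> + (\<Sum>k<Suc M. B \<kappa> k * ch (pt k)))"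
    for ch \<kappa>
  have T_Pup: "\<nu> \<in> Pup \<xi>" if "\<nu> \<in> T" for \<nu> using T(2) that by blast
  have B_sum: "(\<Sum>k<Suc M. B \<kappa> k * ch (pt k)) = (\<Sum>\<nu>\<in>T. w \<nu> * (\<Sum>k<Suc M. pushed \<kappa> \<nu> k * ch (pt k)))"
    for \<kappa> and ch :: "real^'n^'n \<Rightarrow> real"
    unfolding B_def sum_distrib_left sum_distrib_right mult.assoc by (rule sum.swap)
  have "\<exists>\<kappa>\<in>kernels. \<forall>ch\<in>Lip0. - (D + e) < f ch \<kappa>"
  proof (rule minimax_convexlike[OF compact_Lip0])
    show "kernels \<noteq> {}" using nearest_kernel[of "\<lambda>_ _. 0"] by auto
    have coord: "continuous_on Lip0 (\<lambda>ch. ch x)" for x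
      by (rule continuous_on_subset[OF continuous_on_product_coordinates]) simp
    show "continuous_on Lip0 (\<lambda>ch. f ch \<kappa>)" for \<kappa>
      unfolding f_def
      by (intro continuous_on_diff continuous_on_add continuous_on_sum continuous_on_mult
          continuous_on_const coord)
    show "\<exists>ch''\<in>Lip0. \<forall>\<kappa>\<in>kernels. f ch'' \<kappa> \<le> t * f ch \<kappa> + (1 - t) * f ch' \<kappa>"
      if "ch \<in> Lip0" "ch' \<in> Lip0" "0 \<le> t" "t \<le> 1" for ch ch' t
    proof (intro bexI ballI)
      show "(\<lambda>x. t * ch x + (1 - t) * ch' x) \<in> Lip0" using that by (rule Lip0_mix)
      fix \<kappa>
      have "(\<Sum>k<Suc M. v k * (t * ch (pt k) + (1 - t) * ch' (pt k))) =
          t * (\<Sum>k<Suc M. v k * ch (pt k)) + (1 - t) * (\<Sum>k<Suc M. v k * ch' (pt k))" for v :: "nat \<Rightarrow> real"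
        unfolding sum_distrib_left sum.distrib[symmetric] by (intro sum.cong) (auto simp: algebra_simps)
      then show "f (\<lambda>x. t * ch x + (1 - t) * ch' x) \<kappa> \<le> t * f ch \<kappa> + (1 - t) * f ch' \<kappa>"
        unfolding f_def by (simp add: algebra_simps del: sum.lessThan_Suc)
    qed
    show "\<exists>\<kappa>''\<in>kernels. \<forall>ch\<in>Lip0. t * f ch \<kappa> + (1 - t) * f ch \<kappa>' \<le> f ch \<kappa>''"
      if \<kappa>: "\<kappa> \<in> kernels" "\<kappa>' \<in> kernels" and t: "0 \<le> t" "t \<le> 1" for \<kappa> \<kappa>' t
    proof (intro bexI ballI)
      let ?\<kappa> = "\<lambda>k x. t * \<kappa> k x + (1 - t) * \<kappa>' k x"
      show "?\<kappa> \<in> kernels" using kernels_mix[OF \<kappa> t] .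
      have C: "C ?\<kappa> = t * C \<kappa> + (1 - t) * C \<kappa>'"
        unfolding C_def sum_distrib_left sum.distrib[symmetric]
        by (intro sum.cong refl) (simp only: pushed_mix(2)[OF \<kappa> T_Pup], simp add: algebra_simps)
      have B: "B ?\<kappa> k = t * B \<kappa> k + (1 - t) * B \<kappa>' k" for k
        unfolding B_def sum_distrib_left sum.distrib[symmetric]
        by (intro sum.cong refl) (simp only: pushed_mix(1)[OF \<kappa> T_Pup], simp add: algebra_simps)
      fix ch
      have "(\<Sum>k<Suc M. B ?\<kappa> k * ch (pt k)) =
          t * (\<Sum>k<Suc M. B \<kappa> k * ch (pt k)) + (1 - t) * (\<Sum>k<Suc M. B \<kappa>' k * ch (pt k))"
        unfolding B sum_distrib_left sum.distrib[symmetric] by (intro sum.cong) (auto simp: algebra_simps)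
      then show "t * f ch \<kappa> + (1 - t) * f ch \<kappa>' \<le> f ch ?\<kappa>"
        unfolding f_def C by (simp add: algebra_simps del: sum.lessThan_Suc)
    qed
    show "\<exists>\<kappa>\<in>kernels. - (D + e) < f ch \<kappa>" if "ch \<in> Lip0" for ch
    proof -
      obtain \<kappa> g where \<kappa>: "\<kappa> \<in> kernels"
        and lip_g: "\<And>x y. x \<in> Kxi \<xi> \<Longrightarrow> y \<in> Kxi \<xi> \<Longrightarrow> \<bar>g x - g y\<bar> \<le> dist x y"
        and g_le: "\<And>k. k < Suc M \<Longrightarrow> g (pt k) \<le> ch (pt k)"
        and int_g: "\<And>\<nu>. \<nu> \<in> Pup \<xi> \<Longrightarrow>
          cost \<kappa> \<nu> + (\<Sum>k<Suc M. pushed \<kappa> \<nu> k * ch (pt k)) = integral\<^sup>L \<nu> g"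
        by (rule optimal_kernel[of ch]) blast
      \<comment> \<open>\<open>optimal_kernel\<close> leaves the value at \<open>x0\<close> free
        while the ball restricts it. The subtracted constant reappears equally on both sides,
        because w and m have total mass one.\<close>
      define g0 where "g0 x = g x - g (x0 \<xi>)" for x
      have g0: "g0 \<in> Lip_ball \<xi>" unfolding g0_def using lip_g by (rule Lip_ball_shift)
      have int_g0: "integral\<^sup>L \<nu> g = integral\<^sup>L \<nu> g0 + g (x0 \<xi>)" if \<nu>: "\<nu> \<in> T" for \<nu>
      proof -
        interpret prob_space \<nu> using Pup_prob_space[OF T_Pup[OF \<nu>]] .
        have "integral\<^sup>L \<nu> g = (\<integral>x. g0 x + g (x0 \<xi>) \<partial>\<nu>)" by (simp add: g0_def)
        also have "\<dots> = integral\<^sup>L \<nu> g0 + g (x0 \<xi>)"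
          using Lip_ball_integrable[OF Pup_finite_K[OF T_Pup[OF \<nu>]] g0] by (simp add: prob_space)
        finally show ?thesis .
      qed
      have "C \<kappa> + (\<Sum>k<Suc M. B \<kappa> k * ch (pt k))
          = (\<Sum>\<nu>\<in>T. w \<nu> * (cost \<kappa> \<nu> + (\<Sum>k<Suc M. pushed \<kappa> \<nu> k * ch (pt k))))"
        unfolding B_sum C_def sum.distrib[symmetric] distrib_left ..
      also have "\<dots> = (\<Sum>\<nu>\<in>T. w \<nu> * integral\<^sup>L \<nu> g0 + w \<nu> * g (x0 \<xi>))"
        using int_g[OF T_Pup] int_g0 by (intro sum.cong refl) (simp add: distrib_left del: sum.lessThan_Suc)
      also have "\<dots> = (\<Sum>\<nu>\<in>T. w \<nu> * integral\<^sup>L \<nu> g0) + g (x0 \<xi>)"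
        using T(4) by (simp add: sum.distrib sum_distrib_right[symmetric])
      finally have 1: "C \<kappa> + (\<Sum>k<Suc M. B \<kappa> k * ch (pt k)) = (\<Sum>\<nu>\<in>T. w \<nu> * integral\<^sup>L \<nu> g0) + g (x0 \<xi>)" .
      have "(\<Sum>k<Suc M. m k * g0 (pt k)) + g (x0 \<xi>) = (\<Sum>k<Suc M. m k * g0 (pt k)) + (\<Sum>k<Suc M. m k) * g (x0 \<xi>)"
        using m by (simp only: weights_def mem_Collect_eq mult_1_left)
      also have "\<dots> = (\<Sum>k<Suc M. m k * g (pt k))"
        unfolding sum_distrib_right sum.distrib[symmetric] by (intro sum.cong) (auto simp: g0_def algebra_simps)
      also have "\<dots> \<le> (\<Sum>k<Suc M. m k * ch (pt k))"
        using g_le m by (intro sum_mono mult_left_mono) (auto simp: weights_def)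
      finally have "- D \<le> f ch \<kappa>" using D[OF g0] unfolding f_def 1 by linarith
      then show ?thesis using \<kappa> \<open>0 < e\<close> by (intro bexI[of _ \<kappa>]) auto
    qed
  qed
  then obtain \<kappa> where \<kappa>: "\<kappa> \<in> kernels" and f_gt: "\<And>ch. ch \<in> Lip0 \<Longrightarrow> - (D + e) < f ch \<kappa>" by blast
  have pushed: "pushed \<kappa> \<nu> \<in> weights" if "\<nu> \<in> T" for \<nu> using pushed_weights[OF \<kappa> T_Pup[OF that]] .
  have "T \<noteq> {}" using T(4) by auto
  \<comment> \<open>All images lie on the same chain, and by linearity their mixture is
    \<open>B \<kappa>\<close>, the image of the whole mixture.\<close>
  have jensen: "(\<lambda>k. \<Sum>\<nu>\<in>T. w \<nu> * pushed \<kappa> \<nu> k) \<in> weights \<and>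
      (\<Sum>\<nu>\<in>T. w \<nu> * \<phi> (law (pushed \<kappa> \<nu>))) \<le> \<phi> (law (\<lambda>k. \<Sum>\<nu>\<in>T. w \<nu> * pushed \<kappa> \<nu> k))"
    by (rule concave_on_functions_sum[where \<Phi> = "\<lambda>m. \<phi> (law m)" and W = weights])
      (use weights_mix law_concave T \<open>T \<noteq> {}\<close> pushed in auto)
  have Bw: "B \<kappa> \<in> weights" using jensen by (simp add: B_def[abs_def])
  have "(\<Sum>\<nu>\<in>T. w \<nu> * \<phi> \<nu>) \<le> (\<Sum>\<nu>\<in>T. w \<nu> * (\<phi> (law (pushed \<kappa> \<nu>)) + cost \<kappa> \<nu>))"
  proof (intro sum_mono mult_left_mono T(3))
    fix \<nu> assume \<nu>: "\<nu> \<in> T"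
    show "\<phi> \<nu> \<le> \<phi> (law (pushed \<kappa> \<nu>)) + cost \<kappa> \<nu>"
      using lip[OF T_Pup[OF \<nu>] law_Pup[OF pushed[OF \<nu>]]] dP_pushed[OF \<kappa> T_Pup[OF \<nu>]] by linarith
  qed
  also have "\<dots> = (\<Sum>\<nu>\<in>T. w \<nu> * \<phi> (law (pushed \<kappa> \<nu>))) + C \<kappa>"
    by (simp add: C_def distrib_left sum.distrib)
  also have "\<dots> \<le> \<phi> (law (B \<kappa>)) + C \<kappa>" using jensen by (simp add: B_def[abs_def])
  also have "\<phi> (law (B \<kappa>)) \<le> \<phi> (law m) + dP \<xi> (law (B \<kappa>)) (law m)"
    using lip[OF law_Pup[OF Bw] law_Pup[OF m]] by linarith
  \<comment> \<open>Since cost and distance are bounded jointly, the cost \<open>C \<kappa>\<close>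
    spent on reaching the chain is recovered here.\<close>
  also have "dP \<xi> (law (B \<kappa>)) (law m) \<le> D + e - C \<kappa>"
  proof (rule dP_least)
    fix ch assume ch: "ch \<in> Lip_ball \<xi>"
    let ?r = "\<lambda>x. if x \<in> Kxi \<xi> then ch x else 0"
    have "f ?r \<kappa> = f ch \<kappa>"
      unfolding f_def using pt_in_Kxi by (intro arg_cong2[where f = "(-)"] arg_cong2[where f = "(+)"] sum.cong refl) auto
    then have "- (D + e) < f ch \<kappa>" using f_gt[OF Lip0_restrict[OF ch]] by simp
    then show "integral\<^sup>L (law (B \<kappa>)) ch - integral\<^sup>L (law m) ch \<le> D + e - C \<kappa>"
      unfolding integral_law[OF Bw Lip_ball_measurable[OF ch]] integral_law[OF m Lip_ball_measurable[OF ch]] f_def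
      by linarith
  qed
  finally show "(\<Sum>\<nu>\<in>T. w \<nu> * \<phi> \<nu>) \<le> \<phi> (law m) + D + e" by simp
qed

end

section \<open>Passage from chains to arbitrary laws\<close>

context concave_functional
begin

text \<open>Replacing \<mu> by a nearby law on a chain costs e/2 twice: once in the tests against
  \<open>ch\<close>, once in the value of \<open>\<phi>\<close>.\<close>

lemma mixture_le:
  assumes T: "finite T" "T \<subseteq> Pup \<xi>" "\<And>\<nu>. \<nu> \<in> T \<Longrightarrow> 0 \<le> w \<nu>" "sum w T = 1"
    and \<mu>: "\<mu> \<in> Pup \<xi>"
    and D: "\<And>ch. ch \<in> Lip_ball \<xi> \<Longrightarrow> (\<Sum>\<nu>\<in>T. w \<nu> * integral\<^sup>L \<nu> ch) - integral\<^sup>L \<mu> ch \<le> D"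
  shows "(\<Sum>\<nu>\<in>T. w \<nu> * \<phi> \<nu>) \<le> \<phi> \<mu> + D"
proof (rule field_le_epsilon)
  fix e :: real assume "0 < e"
  then have "0 < e / 2" by simp
  then obtain M and a :: "nat \<Rightarrow> real^'n^'n"
    where chain: "\<And>k. k \<le> M \<Longrightarrow> psd (a k) \<and> norm (a k) \<le> 1" "\<And>k. k < M \<Longrightarrow> psd (a (Suc k) - a k)"
      and close: "\<And>ch. ch \<in> Lip_ball \<xi> \<Longrightarrow>
        \<bar>integral\<^sup>L \<mu> ch - (\<Sum>k<Suc M. 1 / real (Suc M) * ch (grad \<xi> (a k)))\<bar> \<le> e / 2"
    by (rule Pup_discretize[OF \<mu>]) blast
  interpret chain_functional \<xi> \<phi> M a
    by unfold_locales (use chain in auto)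
  define m :: "nat \<Rightarrow> real" where "m = (\<lambda>_. 1 / real (Suc M))"
  have m: "m \<in> weights" by (simp add: m_def weights_def del: sum.lessThan_Suc)
  have "(\<Sum>\<nu>\<in>T. w \<nu> * integral\<^sup>L \<nu> ch) - (\<Sum>k<Suc M. m k * ch (pt k)) \<le> D + e / 2"
    if "ch \<in> Lip_ball \<xi>" for ch
    using D[OF that] close[OF that] unfolding m_def pt_def by linarith
  then have "(\<Sum>\<nu>\<in>T. w \<nu> * \<phi> \<nu>) \<le> \<phi> (law m) + (D + e / 2)"
    using mixture_le_chain[OF T m] by blast
  moreover have "dP \<xi> (law m) \<mu> \<le> e / 2"
  proof (rule dP_least)
    fix ch assume ch: "ch \<in> Lip_ball \<xi>"
    show "integral\<^sup>L (law m) ch - integral\<^sup>L \<mu> ch \<le> e / 2"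
      using close[OF ch] unfolding integral_law[OF m Lip_ball_measurable[OF ch]]
      unfolding m_def pt_def by linarith
  qed
  ultimately show "(\<Sum>\<nu>\<in>T. w \<nu> * \<phi> \<nu>) \<le> \<phi> \<mu> + D + e"
    using lip[OF law_Pup[OF m] \<mu>] by linarith
qed

text \<open>A general \<eta> is never compared with \<mu> directly. If \<open>phi_bar\<close>
  exceeded \<open>\<phi> \<mu>\<close>, all dual values would lie above an intermediate c, and the
  finite witness reduces the matter to a finite mixture.\<close>

lemma phi_bar_extends:
  assumes \<mu>: "\<mu> \<in> Pup \<xi>"
  shows "phi_bar \<xi> \<phi> (emb \<mu>) = \<phi> \<mu>"
proof (rule antisym[OF _ phi_bar_ge[OF \<mu>]], rule ccontr)
  assume "\<not> phi_bar \<xi> \<phi> (emb \<mu>) \<le> \<phi> \<mu>"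
  then obtain c where c: "\<phi> \<mu> < c" "c < phi_bar \<xi> \<phi> (emb \<mu>)" using dense not_le by metis
  then have "c < emb \<mu> ch - phi_star \<xi> \<phi> ch" if "ch \<in> Lip_ball \<xi>" for ch
    using phi_bar_le[OF emb_Pup[OF \<mu>] that] by linarith
  then obtain T w where T: "finite T" "T \<subseteq> Pup \<xi>" "\<And>\<nu>. \<nu> \<in> T \<Longrightarrow> 0 \<le> w \<nu>" "sum w T = 1"
    and gt: "\<And>ch. ch \<in> Lip0 \<Longrightarrow>
      c < emb \<mu> ch - (\<Sum>\<nu>\<in>T. w \<nu> * integral\<^sup>L \<nu> ch) + (\<Sum>\<nu>\<in>T. w \<nu> * \<phi> \<nu>)"
    by (rule finite_dual_witness[OF emb_Pup[OF \<mu>]]) blast+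
  \<comment> \<open>By the witness inequality, the mixture exceeds \<mu> by less than the bracketed
    number when tested against any \<open>ch\<close>, so this number can serve as D. The outcome is
    c \<le> \<open>\<phi> \<mu>\<close>.\<close>
  have "(\<Sum>\<nu>\<in>T. w \<nu> * \<phi> \<nu>) \<le> \<phi> \<mu> + ((\<Sum>\<nu>\<in>T. w \<nu> * \<phi> \<nu>) - c)"
  proof (rule mixture_le[OF T \<mu>])
    fix ch assume ch: "ch \<in> Lip_ball \<xi>"
    let ?r = "\<lambda>x. if x \<in> Kxi \<xi> then ch x else 0"
    have "integral\<^sup>L \<nu> ?r = integral\<^sup>L \<nu> ch" if "\<nu> \<in> Pup \<xi>" for \<nu>
      using Pup_space[OF that] by (intro Bochner_Integration.integral_cong) auto
    then have "emb \<mu> ?r = integral\<^sup>L \<mu> ch"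
      "(\<Sum>\<nu>\<in>T. w \<nu> * integral\<^sup>L \<nu> ?r) = (\<Sum>\<nu>\<in>T. w \<nu> * integral\<^sup>L \<nu> ch)"
      using \<mu> T(2) by (auto simp: emb_def intro!: sum.cong)
    then show "(\<Sum>\<nu>\<in>T. w \<nu> * integral\<^sup>L \<nu> ch) - integral\<^sup>L \<mu> ch \<le> (\<Sum>\<nu>\<in>T. w \<nu> * \<phi> \<nu>) - c"
      using gt[OF Lip0_restrict[OF ch]] by linarith
  qed
  then show False using c by linarith
qed

end

text \<open>A supremum of reals is unspecified when unbounded, so the first conjunct certifies that
  \<open>phi_bar\<close> is a genuine one. The last conjunct spells out a minimum: a lower bound
  that is attained.\<close>

theorem theorem5p12:
  fixes \<xi> :: "real^'n::finite^'n \<Rightarrow> real"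
    and \<phi> :: "(real^'n^'n) measure \<Rightarrow> real"
  assumes smooth: "smooth_fun \<xi>"
    and strict: "strictly_convex_on {A. psd A} \<xi>"
    and lip: "\<forall>\<mu>\<in>Pup \<xi>. \<forall>\<nu>\<in>Pup \<xi>. \<bar>\<phi> \<mu> - \<phi> \<nu>\<bar> \<le> dP \<xi> \<mu> \<nu>"
    and pc: "pre_concave \<xi> \<phi>"
  shows "(\<forall>F\<in>M1 \<xi>. bdd_above ((\<lambda>\<eta>. integral\<^sup>L \<eta> \<phi> - dM \<xi> (emb (Bar \<xi> \<eta>)) F) ` PP \<xi>))
    \<and> (\<forall>F\<in>M1 \<xi>. \<forall>G\<in>M1 \<xi>. \<bar>phi_bar \<xi> \<phi> F - phi_bar \<xi> \<phi> G\<bar> \<le> dM \<xi> F G)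
    \<and> (\<forall>F\<in>M1 \<xi>. \<forall>G\<in>M1 \<xi>. \<forall>t::real. 0 \<le> t \<and> t \<le> 1 \<longrightarrow>
         t * phi_bar \<xi> \<phi> F + (1 - t) * phi_bar \<xi> \<phi> G
           \<le> phi_bar \<xi> \<phi> (\<lambda>ch. t * F ch + (1 - t) * G ch))
    \<and> (\<forall>\<mu>\<in>Pup \<xi>. phi_bar \<xi> \<phi> (emb \<mu>) = \<phi> \<mu>)
    \<and> (\<forall>F\<in>M1 \<xi>. (\<exists>ch\<in>Lip_ball \<xi>. phi_bar \<xi> \<phi> F = F ch - phi_star \<xi> \<phi> ch) \<and>
         (\<forall>ch\<in>Lip_ball \<xi>. phi_bar \<xi> \<phi> F \<le> F ch - phi_star \<xi> \<phi> ch))"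
proof -
  interpret concave_functional \<xi> \<phi>
    by unfold_locales (use smooth lip pc in auto)
  note M1 = subsetD[OF M1_subset_Lip_functionals]
  show ?thesis
  proof (intro conjI ballI allI impI)
    fix F assume F: "F \<in> M1 \<xi>"
    show "bdd_above ((\<lambda>\<eta>. integral\<^sup>L \<eta> \<phi> - dM \<xi> (emb (Bar \<xi> \<eta>)) F) ` PP \<xi>)"
      using phi_bar_bdd[OF M1[OF F]] .
    show "\<exists>ch\<in>Lip_ball \<xi>. phi_bar \<xi> \<phi> F = F ch - phi_star \<xi> \<phi> ch"
      using strong_duality[OF M1[OF F]] .
    show "phi_bar \<xi> \<phi> F \<le> F ch - phi_star \<xi> \<phi> ch" if "ch \<in> Lip_ball \<xi>" for ch
      using phi_bar_le[OF M1[OF F] that] .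
    fix G assume G: "G \<in> M1 \<xi>"
    show "\<bar>phi_bar \<xi> \<phi> F - phi_bar \<xi> \<phi> G\<bar> \<le> dM \<xi> F G"
      using phi_bar_lipschitz[OF M1[OF F] M1[OF G]] .
    show "t * phi_bar \<xi> \<phi> F + (1 - t) * phi_bar \<xi> \<phi> G \<le> phi_bar \<xi> \<phi> (\<lambda>ch. t * F ch + (1 - t) * G ch)"
      if "0 \<le> t \<and> t \<le> 1" for t
      using phi_bar_concave[OF M1[OF F] M1[OF G]] that by blast
  next
    show "phi_bar \<xi> \<phi> (emb \<mu>) = \<phi> \<mu>" if "\<mu> \<in> Pup \<xi>" for \<mu>
      using phi_bar_extends[OF that] .
  qed
qed

end
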